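(* Assume that $\rho(A_0)<1$ and that the noise $(\xi_n)_{n\ge1}$ satisfies: $r(n)=O(n^{-\alpha_1})$ as $n\to\infty$ for some $\alpha_1>0$; $\int_{-\pi}^{\pi}|\log f_\xi(\lambda)|\,d\lambda<\infty$; and $\beta_n^2=O(n^{-\alpha_2})$ for some $\alpha_2>1$. Let $\zeta_n^{(1)}\in\mathbb{R}^p$ denote the first $p$ components of $\zeta_n$. Consider the process $$\gamma_n=A_0\gamma_{n-1}+\ell^1\sigma_\infty\varepsilon_n,\qquad n\ge1,$$ where $\ell^1=(1,0,\dots,0)^*\in\mathbb{R}^p$, $\sigma_\infty>0$ is the limit of $\sigma_n$, and $\gamma_0$ has the stationary distribution associated with this autoregressive relation, so that $(\gamma_n)$ is strictly stationary and ergodic. Then $\|\zeta_n^{(1)}-\gamma_n\|\to0$ almost surely as $n\to\infty$.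
   Context: Fix an integer $p\ge1$. $A^*$ is the transpose of $A$, $\|\cdot\|$ the Euclidean norm, $Id_p$ the $p\times p$ identity matrix, $\rho(\cdot)$ the spectral radius. Noise: $(\xi_n)_{n\ge1}$ is a real stationary centered Gaussian process with covariance function $r(n)=\mathbb{E}(\xi_1\xi_{1+n})$, $r(0)=1$, and spectral density $f_\xi$. Let $\sigma_1\varepsilon_1=\xi_1$, $\sigma_1=1$, and for $n\ge2$, $\sigma_n\varepsilon_n=\xi_n-\mathbb{E}(\xi_n\mid\xi_1,\dots,\xi_{n-1})$, where $\sigma_n>0$ and the $\varepsilon_n$ are i.i.d. $\mathcal N(0,1)$. Write $\sigma_n\varepsilon_n=\sum_{i=1}^n k(n,i)\xi_i$ with deterministic $k(n,i)$, $k(n,n)=1$. For $n\ge1$, $\beta_n=-k(n+1,1)$ (the partial autocorrelation function, PACF, of $(\xi_n)$); by convention $\beta_0=1$ (it plays no role below since $\zeta_0=0$). One has $\sigma_n^2=\prod_{i=1}^{n-1}(1-\beta_i^2)$, and under the assumptions $\sigma_n^2\to\sigma_\infty^2>0$. Model: $X_n=\sum_{i=1}^p\theta_iX_{n-i}+\xi_n$ for $n\ge1$, with $X_n=0$ for $n\le0$ and $\theta=(\theta_1,\dots,\theta_p)^*\in\mathbb{R}^p$. $A_0$ is the $p\times p$ companion matrix with first row $(\theta_1,\dots,\theta_p)$, ones on the subdiagonal and zeros elsewhere. Let $Y_n=(X_n,\dots,X_{n-p+1})^*$, $Z_n=\sum_{i=1}^nk(n,i)Y_i$, and $\zeta_n=\begin{pmatrix}Z_n\\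 \sum_{k=1}^{n-1}\beta_kZ_k\end{pmatrix}\in\mathbb{R}^{2p}$ for $n\ge1$, $\zeta_0=0$. Then $\zeta_n=\widetilde A_{n-1}\zeta_{n-1}+\ell\sigma_n\varepsilon_n$ with $\widetilde A_n=\begin{pmatrix}A_0&\beta_nA_0\\ \beta_nId_p&Id_p\end{pmatrix}$ and $\ell=(1,0,\dots,0)^*\in\mathbb{R}^{2p}$. *)

theory Defs
  imports
    "HOL-Probability.Probability"
    "HOL-Library.Landau_Symbols"
    "Jordan_Normal_Form.Spectral_Radius"
begin

no_notation Finite_Cartesian_Product.vec_nth (infixl "$" 90)

section \<open>Stochastic processes\<close>

text \<open>A Gaussian variable may be degenerate (almost surely constant).\<close>

definition gaussian_rv :: "'w measure \<Rightarrow> ('w \<Rightarrow> real) \<Rightarrow> bool" where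
  "gaussian_rv M U \<longleftrightarrow> U \<in> borel_measurable M \<and>
     (\<exists>m. (AE \<omega> in M. U \<omega> = m) \<or> (\<exists>s>0. distributed M lborel U (normal_density m s)))"

definition gaussian_process :: "'w measure \<Rightarrow> 'i set \<Rightarrow> ('i \<Rightarrow> 'w \<Rightarrow> real) \<Rightarrow> bool" where
  "gaussian_process M T U \<longleftrightarrow>
     (\<forall>I c. finite I \<and> I \<subseteq> T \<longrightarrow> gaussian_rv M (\<lambda>\<omega>. \<Sum>i\<in>I. c i * U i \<omega>))"

text \<open>For both notions below, \<^term>\<open>N\<close> is the state space, the process is indexed by all
  natural numbers, and its law lives on the path space \<^term>\<open>Pi\<^sub>M UNIV (\<lambda>_::nat. N)\<close>.
  A process indexed by the positive integers is treated after re-indexing by \<^term>\<open>Suc\<close>.\<close>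

definition strictly_stationary ::
    "'w measure \<Rightarrow> 'b measure \<Rightarrow> (nat \<Rightarrow> 'w \<Rightarrow> 'b) \<Rightarrow> bool" where
  "strictly_stationary M N U \<longleftrightarrow> (\<forall>n. U n \<in> measurable M N) \<and>
     (\<forall>m. distr M (Pi\<^sub>M UNIV (\<lambda>_::nat. N)) (\<lambda>\<omega> n. U (n + m) \<omega>) =
          distr M (Pi\<^sub>M UNIV (\<lambda>_::nat. N)) (\<lambda>\<omega> n. U n \<omega>))"

definition ergodic_process ::
    "'w measure \<Rightarrow> 'b measure \<Rightarrow> (nat \<Rightarrow> 'w \<Rightarrow> 'b) \<Rightarrow> bool" where
  "ergodic_process M N U \<longleftrightarrow>
     (\<forall>B \<in> sets (Pi\<^sub>M UNIV (\<lambda>_::nat. N)).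
        (\<lambda>x n. x (Suc n)) -` B \<inter> space (Pi\<^sub>M UNIV (\<lambda>_::nat. N)) = B \<longrightarrow>
        measure M {\<omega> \<in> space M. (\<lambda>n. U n \<omega>) \<in> B} \<in> {0, 1})"

section \<open>The noise\<close>

definition acov :: "'w measure \<Rightarrow> (nat \<Rightarrow> 'w \<Rightarrow> real) \<Rightarrow> nat \<Rightarrow> real" where
  "acov M \<xi> n = (\<integral>\<omega>. \<xi> 1 \<omega> * \<xi> (1 + n) \<omega> \<partial>M)"

text \<open>Since \<^term>\<open>r\<close> is real, the Fourier coefficients of negative index are determined by those
  of nonnegative index.\<close>

definition spectral_density :: "(nat \<Rightarrow> real) \<Rightarrow> (real \<Rightarrow> real) \<Rightarrow> bool" where
  "spectral_density r f \<longleftrightarrow>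
     f \<in> borel_measurable borel \<and>
     (\<forall>t\<in>{-pi..pi}. 0 \<le> f t) \<and>
     set_integrable lborel {-pi..pi} f \<and>
     (\<forall>n. complex_of_real (r n) =
        set_lebesgue_integral lborel {-pi..pi} (\<lambda>t. cis (real n * t) * complex_of_real (f t)))"

text \<open>As \<^term>\<open>ln 0\<close> is a real number in HOL, integrability of the logarithm (with
  $\log 0 = -\infty$) has to include that \<^term>\<open>f\<close> is almost everywhere positive.\<close>

definition log_integrable :: "(real \<Rightarrow> real) \<Rightarrow> bool" where
  "log_integrable f \<longleftrightarrow>
     (AE t in lborel. t \<in> {-pi..pi} \<longrightarrow> 0 < f t) \<and>
     set_integrable lborel {-pi..pi} (\<lambda>t. ln (f t))"

text \<open>The sigma-algebra generated by $\xi_1,\dots,\xi_{n-1}$.\<close>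

definition past :: "'w measure \<Rightarrow> (nat \<Rightarrow> 'w \<Rightarrow> real) \<Rightarrow> nat \<Rightarrow> 'w measure" where
  "past M \<xi> n = sigma (space M) (\<Union>i\<in>{1..<n}. {\<xi> i -` B \<inter> space M | B. B \<in> sets borel})"

definition innovation :: "'w measure \<Rightarrow> (nat \<Rightarrow> 'w \<Rightarrow> real) \<Rightarrow> nat \<Rightarrow> 'w \<Rightarrow> real" where
  "innovation M \<xi> n \<omega> =
     (if n = 1 then \<xi> 1 \<omega> else \<xi> n \<omega> - real_cond_exp M (past M \<xi> n) (\<xi> n) \<omega>)"

definition pacf :: "(nat \<Rightarrow> nat \<Rightarrow> real) \<Rightarrow> nat \<Rightarrow> real" where
  "pacf k n = (if n = 0 then 1 else - k (n + 1) 1)"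

section \<open>The autoregressive model\<close>

text \<open>The coefficients are $\theta_1,\dots,\theta_p$, whereas matrix and vector entries are
  numbered from 0.\<close>

definition companion :: "nat \<Rightarrow> (nat \<Rightarrow> real) \<Rightarrow> real mat" where
  "companion p \<theta> = mat p p (\<lambda>(i, j). if i = 0 then \<theta> (j + 1) else if i = j + 1 then 1 else 0)"

text \<open>The following functions act on one path \<^term>\<open>x\<close> of the noise. The model has $X_n = 0$
  for all $n \le 0$; this is what truncated subtraction yields, in \<open>ar_X\<close> as well as
  in \<open>ar_Y\<close>.\<close>

fun ar_X :: "nat \<Rightarrow> (nat \<Rightarrow> real) \<Rightarrow> (nat \<Rightarrow> real) \<Rightarrow> nat \<Rightarrow> real" where
  "ar_X p \<theta> x 0 = 0"
| "ar_X p \<theta> x (Suc n) = (\<Sum>i=1..p. \<theta> i * ar_X p \<theta> x (Suc n - i)) + x (Suc n)"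

definition ar_Y :: "nat \<Rightarrow> (nat \<Rightarrow> real) \<Rightarrow> (nat \<Rightarrow> real) \<Rightarrow> nat \<Rightarrow> real vec" where
  "ar_Y p \<theta> x n = vec p (\<lambda>j. ar_X p \<theta> x (n - j))"

definition ar_Z :: "nat \<Rightarrow> (nat \<Rightarrow> real) \<Rightarrow> (nat \<Rightarrow> nat \<Rightarrow> real) \<Rightarrow> (nat \<Rightarrow> real) \<Rightarrow> nat \<Rightarrow> real vec" where
  "ar_Z p \<theta> k x n = vec p (\<lambda>j. \<Sum>i=1..n. k n i * ar_Y p \<theta> x i $ j)"

definition ar_zeta :: "nat \<Rightarrow> (nat \<Rightarrow> real) \<Rightarrow> (nat \<Rightarrow> nat \<Rightarrow> real) \<Rightarrow> (nat \<Rightarrow> real) \<Rightarrow> nat \<Rightarrow> real vec" where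
  "ar_zeta p \<theta> k x n =
     (if n = 0 then 0\<^sub>v (2 * p)
      else ar_Z p \<theta> k x n @\<^sub>v vec p (\<lambda>j. \<Sum>m=1..<n. pacf k m * ar_Z p \<theta> k x m $ j))"

definition eucl_norm :: "real vec \<Rightarrow> real" where
  "eucl_norm v = sqrt (\<Sum>i<dim_vec v. (v $ i)\<^sup>2)"

section \<open>The stationary autoregression\<close>

text \<open>The Borel sigma-algebra of $\mathbb{R}^p$, transported to \<^term>\<open>carrier_vec p\<close>.\<close>

definition vec_borel :: "nat \<Rightarrow> real vec measure" where
  "vec_borel p = vimage_algebra (carrier_vec p) (\<lambda>v. \<lambda>i\<in>{..<p}. v $ i) (Pi\<^sub>M {..<p} (\<lambda>_. borel))"

definition ar_step :: "nat \<Rightarrow> real mat \<Rightarrow> real \<Rightarrow> real vec \<Rightarrow> real \<Rightarrow> real vec" where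
  "ar_step p A s v e = A *\<^sub>v v + (s * e) \<cdot>\<^sub>v unit_vec p 0"

definition ar_stationary_law :: "nat \<Rightarrow> real mat \<Rightarrow> real \<Rightarrow> real vec measure \<Rightarrow> bool" where
  "ar_stationary_law p A s \<mu> \<longleftrightarrow>
     prob_space \<mu> \<and> sets \<mu> = sets (vec_borel p) \<and>
     distr (\<mu> \<Otimes>\<^sub>M density lborel std_normal_density) (vec_borel p) (\<lambda>(v, e). ar_step p A s v e) = \<mu>"

end

theory Submission
  imports Defs "HOL-Real_Asymp.Real_Asymp"
begin

text \<open>
  Orthogonality of the innovations to the past determines the coefficients \<open>k(n,i)\<close>, hence
  they satisfy the Levinson--Durbin recursion. It yields
  \<open>\<sigma>(n+1)\<^sup>2 = \<sigma>(n)\<^sup>2 (1 - \<beta>(n)\<^sup>2)\<close>, so that \<open>\<sigma>(n)\<close> converges to a positive limit at a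
  polynomial rate, and it turns the second block \<open>W(n)\<close> of \<open>\<zeta>(n)\<close> into the backward
  prediction error, whence
  \<open>Z(n+1) = A\<^sub>0 (Z(n) + \<beta>(n) W(n)) + \<ell> \<sigma>(n+1) \<epsilon>(n+1)\<close> and \<open>W(n+1) = W(n) + \<beta>(n) Z(n)\<close>.

  The comparison with \<open>\<gamma>\<close> is made path by path. Almost surely \<open>\<epsilon>(n) = O(n\<^sup>\<delta>)\<close> for each
  \<open>\<delta> > 0\<close>. As \<open>\<beta>\<close> is square summable, \<open>\<Sum>m<n. \<bar>\<beta>(m)\<bar>\<close> is \<open>O(n powr (1/2))\<close> by Cauchy--Schwarz, so with
  \<open>\<beta>(n) = O(n powr (-\<alpha>\<^sub>2/2))\<close> the feedback \<open>\<beta>(n) W(n)\<close> is a vanishing multiple of the size of \<open>Z\<close>;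
  hence \<open>Z(n) = O(n\<^sup>\<delta>)\<close> and \<open>\<beta>(n) W(n) \<rightarrow> 0\<close>. The difference \<open>Z - \<gamma>\<close> then solves a stable linear
  recursion with vanishing input.

  For the ergodicity of \<open>\<gamma>\<close>, two paths that are driven by the same noise and start from independent
  stationary states merge. Since both have the same law, no shift-invariant event separates them with
  positive probability, so such an event depends on the noise after any given time only, and
  Kolmogorov's zero-one law applies.
\<close>

section \<open>Scalar recursions\<close>

text \<open>All exponents come from one budget. With
  \<open>\<alpha>\<^sub>2 = 1 + 4 * \<delta>\<close> the PACF is of order n to the power -1/2 -
  2\<delta>. The power 1/2 pays for Cauchy-Schwarz, one \<delta> for the growth of the innovations,
  and one \<delta> is left as decay. The same growth forces a rate for \<sigma>(n): as \<epsilon>(n)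
  is almost surely unbounded, mere convergence of \<sigma>(n) would not make (\<sigma>(n) -
  \<sigma>_inf) \<epsilon>(n) vanish, whereas the order -2\<delta> does. The powers of the companion
  matrix decay only up to a constant that may exceed 1, so a single step need not contract the norm
  in use. Norms are therefore replaced by scalar majorants that contract by exactly t. For
  ergodicity the obstacle is that two paths may be arbitrarily close and yet be separated by a
  measurable set. Merging alone says nothing about such a set. With equal laws, however, the sets on
  which the memberships agree in the limit form a sigma-algebra, and the half-spaces of single
  coordinates belong to it.\<close>

lemma linear_rec_tendsto_0:
  fixes d u :: "nat \<Rightarrow> real"
  assumes t: "0 \<le> t" "t < 1" and u: "u \<longlonglongrightarrow> 0"
    and rec: "\<And>n. d (Suc n) = t * d n + u n"
  shows "d \<longlonglongrightarrow> 0"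
proof (rule LIMSEQ_I)
  fix e :: real assume e: "e > 0"
  \<comment> \<open>Chosen so that \<open>t * (e / 2) + e' = e / 2\<close>: the level e / 2
    reproduces itself once the input is below e'.\<close>
  define e' where "e' = (1 - t) * (e / 2)"
  have "e' > 0" using t e by (simp add: e'_def)
  from LIMSEQ_D[OF u this] obtain N where N: "\<And>n. n \<ge> N \<Longrightarrow> \<bar>u n\<bar> < e'" by auto
  have b: "\<bar>d (N + k)\<bar> \<le> t ^ k * \<bar>d N\<bar> + e / 2" for k
  proof (induction k)
    case 0 then show ?case using e by simp
  next
    case (Suc k)
    have "\<bar>d (N + Suc k)\<bar> \<le> t * \<bar>d (N + k)\<bar> + \<bar>u (N + k)\<bar>"
      using rec[of "N + k"] t abs_triangle_ineq[of "t * d (N+k)" "u (N+k)"] by (simp add: abs_mult)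
    also have "\<dots> \<le> t * (t ^ k * \<bar>d N\<bar> + e / 2) + e'"
      by (intro add_mono mult_left_mono Suc t less_imp_le[OF N]) auto
    also have "\<dots> = t ^ Suc k * \<bar>d N\<bar> + e / 2" by (simp add: e'_def field_simps)
    finally show ?case .
  qed
  have "(\<lambda>k. t ^ k * \<bar>d N\<bar>) \<longlonglongrightarrow> 0"
    using t by (intro tendsto_mult_left_zero LIMSEQ_power_zero) auto
  from LIMSEQ_D[OF this, of "e/2"] e obtain K where "\<And>k. k \<ge> K \<Longrightarrow> norm (t ^ k * \<bar>d N\<bar> - 0) < e / 2" by fastforce
  then have K: "\<And>k. k \<ge> K \<Longrightarrow> t ^ k * \<bar>d N\<bar> < e / 2" by fastforce
  show "\<exists>no. \<forall>n\<ge>no. norm (d n - 0) < e"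
  proof (intro exI[of _ "N + K"] allI impI)
    fix n assume n: "N + K \<le> n"
    have "\<bar>d n\<bar> \<le> t ^ (n - N) * \<bar>d N\<bar> + e / 2" using b[of "n - N"] n by simp
    moreover have "t ^ (n - N) * \<bar>d N\<bar> < e / 2" using n by (intro K) simp
    ultimately have "\<bar>d n\<bar> < e" by linarith
    then show "norm (d n - 0) < e" by simp
  qed
qed

lemma abs_sum_le_sqrt:
  fixes b :: "nat \<Rightarrow> real"
  assumes "summable (\<lambda>n. (b n)\<^sup>2)"
  shows "(\<Sum>m<n. \<bar>b m\<bar>) \<le> sqrt (real n) * sqrt (\<Sum>m. (b m)\<^sup>2)"
proof -
  have "(\<Sum>m<n. \<bar>b m\<bar>)\<^sup>2 \<le> real n * (\<Sum>m<n. (b m)\<^sup>2)"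
    using sum_squared_le_sum_of_squares[of "\<lambda>m. \<bar>b m\<bar>" "{..<n}"] by (simp add: mult.commute)
  also have "\<dots> \<le> real n * (\<Sum>m. (b m)\<^sup>2)"
    by (intro mult_left_mono sum_le_suminf assms) auto
  finally have "sqrt ((\<Sum>m<n. \<bar>b m\<bar>)\<^sup>2) \<le> sqrt (real n * (\<Sum>m. (b m)\<^sup>2))" by (rule real_sqrt_le_mono)
  then show ?thesis by (simp add: real_sqrt_mult sum_nonneg)
qed

text \<open>A bootstrap: \<open>w n\<close> involves all earlier values of z, so the growth bound on
  z is carried by strong induction with one constant K. If z has kept below K (n + 1)^\<delta> so
  far, the feedback at n is at most this bound times a factor tending to 0, which the gap 1 - t
  absorbs.\<close>

lemma coupled_rec_tendsto_0:
  fixes b z w g :: "nat \<Rightarrow> real"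
  assumes t: "0 \<le> t" "t < 1" and C: "C \<ge> 0" and \<delta>: "\<delta> > 0"
    and nonneg: "\<And>n. z n \<ge> 0" "\<And>n. w n \<ge> 0"
    and b_sum: "summable (\<lambda>n. (b n)\<^sup>2)"
    and b_bound: "(\<lambda>n. b n) \<in> O(\<lambda>n. real n powr (- (1/2 + 2 * \<delta>)))"
    and g_bound: "\<And>n. g n \<le> G * (real n + 1) powr \<delta>"
    and z_rec: "\<And>n. z (Suc n) \<le> t * z n + C * \<bar>b n\<bar> * w n + g n"
    and w_bound: "\<And>n. w n \<le> C * (\<Sum>m<n. \<bar>b m\<bar> * z m)"
  shows "(\<lambda>n. b n * w n) \<longlonglongrightarrow> 0"
proof -
  define S where "S = sqrt (\<Sum>m. (b m)\<^sup>2)"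
  have S0: "S \<ge> 0" unfolding S_def by (simp add: suminf_nonneg b_sum)
  \<comment> \<open>What Cauchy-Schwarz leaves of \<open>\<bar>b n\<bar> * w n\<close> per unit of
    the bound on the past of z.\<close>
  define B where "B n = \<bar>b n\<bar> * (C * (sqrt (real n) * S))" for n
  have B0: "B n \<ge> 0" for n using C S0 by (simp add: B_def)
  \<comment> \<open>Exponents: -1/2 - 2\<delta> from b, 1/2 from the square root, \<delta> from the
    growth of z; there remains -\<delta>.\<close>
  have B_decay: "(\<lambda>n. B n * (real n + 1) powr \<delta>) \<longlonglongrightarrow> 0"
  proof -
    have "(\<lambda>n. B n * (real n + 1) powr \<delta>) \<in>
       O(\<lambda>n. real n powr (- (1/2 + 2 * \<delta>)) * (1 * (sqrt (real n) * 1)) * (real n + 1) powr \<delta>)"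
      unfolding B_def by (intro landau_o.big.mult landau_o.big_refl) (use b_bound in auto)
    moreover have "(\<lambda>n. real n powr (- (1/2 + 2 * \<delta>)) * (1 * (sqrt (real n) * 1)) * (real n + 1) powr \<delta>) \<longlonglongrightarrow> 0"
      using \<delta> by real_asymp
    then have "(\<lambda>n. real n powr (- (1/2 + 2 * \<delta>)) * (1 * (sqrt (real n) * 1)) * (real n + 1) powr \<delta>) \<in> o(\<lambda>_. 1)"
      by (intro smalloI_tendsto) auto
    ultimately have "(\<lambda>n. B n * (real n + 1) powr \<delta>) \<in> o(\<lambda>_. 1)"
      by (rule landau_o.big_small_trans)
    then show ?thesis by (auto dest: smalloD_tendsto)
  qed
  have w_B: "\<bar>b n\<bar> * w n \<le> K * (real n + 1) powr \<delta> * B n"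
    if K: "K \<ge> 0" and zK: "\<And>m. m < n \<Longrightarrow> z m \<le> K * (real m + 1) powr \<delta>" for K n
  proof -
    have "(\<Sum>m<n. \<bar>b m\<bar> * z m) \<le> (\<Sum>m<n. \<bar>b m\<bar> * (K * (real n + 1) powr \<delta>))"
    proof (intro sum_mono mult_left_mono)
      fix m assume "m \<in> {..<n}"
      then have "z m \<le> K * (real m + 1) powr \<delta>" using zK by auto
      also have "\<dots> \<le> K * (real n + 1) powr \<delta>"
        using K \<delta> \<open>m \<in> {..<n}\<close> by (intro mult_left_mono powr_mono2) auto
      finally show "z m \<le> K * (real n + 1) powr \<delta>" .
    qed auto
    also have "\<dots> = (\<Sum>m<n. \<bar>b m\<bar>) * (K * (real n + 1) powr \<delta>)" by (simp add: sum_distrib_right)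
    also have "\<dots> \<le> (sqrt (real n) * S) * (K * (real n + 1) powr \<delta>)"
      using abs_sum_le_sqrt[OF b_sum, of n] K unfolding S_def by (intro mult_right_mono) auto
    finally have "C * (\<Sum>m<n. \<bar>b m\<bar> * z m) \<le> C * ((sqrt (real n) * S) * (K * (real n + 1) powr \<delta>))"
      using C by (intro mult_left_mono)
    with w_bound[of n] have "w n \<le> C * ((sqrt (real n) * S) * (K * (real n + 1) powr \<delta>))" by linarith
    then have "\<bar>b n\<bar> * w n \<le> \<bar>b n\<bar> * (C * ((sqrt (real n) * S) * (K * (real n + 1) powr \<delta>)))"
      by (intro mult_left_mono) auto
    then show ?thesis by (simp add: B_def mult_ac)
  qed
  have "(\<lambda>n. C * B n) \<longlonglongrightarrow> 0"
  proof (rule Lim_null_comparison)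
    show "(\<lambda>n. C * (B n * (real n + 1) powr \<delta>)) \<longlonglongrightarrow> 0" using tendsto_mult_right_zero[OF B_decay] .
    show "\<forall>\<^sub>F n in sequentially. norm (C * B n) \<le> C * (B n * (real n + 1) powr \<delta>)"
    proof (intro always_eventually allI)
      fix n
      have "B n * 1 \<le> B n * (real n + 1) powr \<delta>" using B0 \<delta> by (intro mult_left_mono ge_one_powr_ge_zero) auto
      then have "C * B n \<le> C * (B n * (real n + 1) powr \<delta>)" using C by (intro mult_left_mono) auto
      then show "norm (C * B n) \<le> C * (B n * (real n + 1) powr \<delta>)" using C B0 by simp
    qed
  qed
  then have "\<forall>\<^sub>F n in sequentially. C * B n < (1 - t) / 2" using t by (intro order_tendstoD) auto
  then obtain N where N: "\<And>n. n \<ge> N \<Longrightarrow> C * B n < (1 - t) / 2" by (auto simp: eventually_sequentially)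
  \<comment> \<open>The sum settles the indices up to N; the second term makes
    \<open>\<bar>G\<bar>\<close> at most K (1 - t) / 2. Beyond N the shares t, (1 - t) / 2 of the
    feedback and (1 - t) / 2 of the input add up to 1.\<close>
  define K where "K = (\<Sum>n\<le>N. z n) + 2 * \<bar>G\<bar> / (1 - t)"
  have K0: "K \<ge> 0" using nonneg t by (auto simp: K_def intro!: add_nonneg_nonneg sum_nonneg)
  have zK: "z n \<le> K * (real n + 1) powr \<delta>" for n
  proof (induction n rule: less_induct)
    case (less n)
    show ?case
    proof (cases "n \<le> N")
      case True
      have "z n \<le> (\<Sum>n\<le>N. z n)" using nonneg True by (intro member_le_sum) auto
      also have "\<dots> \<le> K" using t by (simp add: K_def)
      also have "K * 1 \<le> K * (real n + 1) powr \<delta>" using K0 \<delta> by (intro mult_left_mono ge_one_powr_ge_zero) auto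
      finally show ?thesis by simp
    next
      case False
      then obtain m where m: "n = Suc m" "N \<le> m" by (cases n) auto
      define P where "P = (real m + 1) powr \<delta>"
      have P0: "P \<ge> 0" by (simp add: P_def)
      have G: "\<bar>G\<bar> \<le> K * ((1 - t) / 2)"
        using t nonneg by (auto simp: K_def divide_simps sum_nonneg intro!: mult_nonneg_nonneg)
      have "z n \<le> t * z m + C * (\<bar>b m\<bar> * w m) + g m" using z_rec[of m] m by (simp add: mult_ac)
      also have "\<dots> \<le> t * (K * P) + C * (K * P * B m) + \<bar>G\<bar> * P"
      proof (intro add_mono mult_left_mono t C)
        show "z m \<le> K * P" unfolding P_def using less m by auto
        show "\<bar>b m\<bar> * w m \<le> K * P * B m" unfolding P_def using less m by (intro w_B K0) auto
        show "g m \<le> \<bar>G\<bar> * P" using g_bound[of m] P0 unfolding P_def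
          by (meson abs_ge_self mult_right_mono order_trans)
      qed
      also have "C * (K * P * B m) = (K * P) * (C * B m)" by simp
      also have "\<dots> \<le> (K * P) * ((1 - t) / 2)" using N[of m] m K0 P0 by (intro mult_left_mono) auto
      also have "\<bar>G\<bar> * P \<le> K * ((1 - t) / 2) * P" using G P0 by (intro mult_right_mono)
      finally have "z n \<le> K * P" by (simp add: field_simps)
      also have "\<dots> \<le> K * (real n + 1) powr \<delta>" unfolding P_def m
        using K0 \<delta> by (intro mult_left_mono powr_mono2) auto
      finally show ?thesis .
    qed
  qed
  show ?thesis
  proof (rule Lim_null_comparison)
    show "(\<lambda>n. K * (B n * (real n + 1) powr \<delta>)) \<longlonglongrightarrow> 0" using tendsto_mult_right_zero[OF B_decay] .
    show "\<forall>\<^sub>F n in sequentially. norm (b n * w n) \<le> K * (B n * (real n + 1) powr \<delta>)"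
      using w_B[OF K0 zK] nonneg by (auto simp: abs_mult mult_ac)
  qed
qed

text \<open>The weights give the rate: for j \<ge> n the square of \<open>b j\<close> is at most n
  to the power -q times its weighted version, and \<open>s n - s (n + m)\<close> telescopes into
  such squares because s \<le> 1. The limit is positive because it is a convergent infinite product
  of positive factors.\<close>

lemma product_rec_limit:
  fixes s b :: "nat \<Rightarrow> real"
  assumes pos: "\<And>n. n \<ge> 1 \<Longrightarrow> s n > 0" and s1: "s 1 = 1"
    and rec: "\<And>n. n \<ge> 1 \<Longrightarrow> s (Suc n) = s n * (1 - (b n)\<^sup>2)"
    and q: "q > 0" and b_sum: "summable (\<lambda>n. real n powr q * (b n)\<^sup>2)"
  obtains L D where "L > 0" "s \<longlonglongrightarrow> L" "\<And>n. n \<ge> 1 \<Longrightarrow> \<bar>s n - L\<bar> \<le> D * real n powr (- q)"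
proof -
  define R where "R = (\<Sum>n. real n powr q * (b n)\<^sup>2)"
  have b_lt: "(b n)\<^sup>2 < 1" if "n \<ge> 1" for n
    using rec[OF that] pos[OF that] pos[of "Suc n"] zero_less_mult_pos[of "s n" "1 - (b n)\<^sup>2"] by simp
  have dec: "s (Suc n) \<le> s n" if "n \<ge> 1" for n
    using rec[OF that] pos[OF that] by (simp add: mult_left_le)
  have s_le: "s n \<le> 1" if "n \<ge> 1" for n
    using that by (induction n rule: dec_induct) (use s1 dec order_trans in \<open>auto\<close>)
  have b_sum': "summable (\<lambda>n. (b (Suc n))\<^sup>2)"
  proof (rule summable_comparison_test'[OF b_sum[THEN summable_Suc_iff[THEN iffD2]]])
    fix n
    have "1 * (b (Suc n))\<^sup>2 \<le> real (Suc n) powr q * (b (Suc n))\<^sup>2"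
      using q by (intro mult_right_mono ge_one_powr_ge_zero) auto
    then show "norm ((b (Suc n))\<^sup>2) \<le> real (Suc n) powr q * (b (Suc n))\<^sup>2" by simp
  qed
  have tail: "s n - s (n + m) \<le> R * real n powr (- q)" if n: "n \<ge> 1" for n m
  proof -
    have "s n - s (n + m) \<le> (\<Sum>j\<in>{n..<n+m}. (b j)\<^sup>2)"
    proof (induction m)
      case 0 show ?case by simp
    next
      case (Suc m)
      have "s (n + m) - s (n + Suc m) = s (n + m) * (b (n + m))\<^sup>2"
        using rec[of "n + m"] n by (simp add: algebra_simps)
      also have "\<dots> \<le> 1 * (b (n + m))\<^sup>2" using s_le[of "n+m"] n by (intro mult_right_mono) auto
      finally show ?case using Suc by simp
    qed
    also have "\<dots> \<le> (\<Sum>j\<in>{n..<n+m}. (real j powr q * (b j)\<^sup>2) * real n powr (- q))"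
    proof (intro sum_mono)
      fix j assume j: "j \<in> {n..<n+m}"
      have "1 = real n powr q * real n powr (- q)" using n by (simp add: powr_minus)
      also have "\<dots> \<le> real j powr q * real n powr (- q)" using j q n by (intro mult_right_mono powr_mono2) auto
      finally have "1 * (b j)\<^sup>2 \<le> (real j powr q * real n powr (- q)) * (b j)\<^sup>2" by (intro mult_right_mono) auto
      then show "(b j)\<^sup>2 \<le> (real j powr q * (b j)\<^sup>2) * real n powr (- q)" by (simp add: mult_ac)
    qed
    also have "\<dots> = (\<Sum>j\<in>{n..<n+m}. real j powr q * (b j)\<^sup>2) * real n powr (- q)" by (simp add: sum_distrib_right)
    also have "\<dots> \<le> R * real n powr (- q)"
      unfolding R_def by (intro mult_right_mono sum_le_suminf b_sum) auto
    finally show ?thesis .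
  qed
  \<comment> \<open>The product starts with \<open>b 1\<close>: for the PACF, \<open>b 0\<close> is
    1 and its factor would be 0.\<close>
  have "convergent_prod (\<lambda>n. 1 - (b (Suc n))\<^sup>2)"
    using summable_imp_convergent_prod_real[of "\<lambda>n. - (b (Suc n))\<^sup>2"] b_sum' b_lt by (simp add: summable_minus_iff less_imp_neq)
  then have lim: "(\<lambda>n. \<Prod>j\<le>n. 1 - (b (Suc j))\<^sup>2) \<longlonglongrightarrow> (\<Prod>j. 1 - (b (Suc j))\<^sup>2)"
    and "(\<Prod>j. 1 - (b (Suc j))\<^sup>2) > 0"
    by (auto intro!: convergent_prod_LIMSEQ less_0_prodinf simp: b_lt)
  moreover have s_prod: "s (Suc (Suc n)) = (\<Prod>j\<le>n. 1 - (b (Suc j))\<^sup>2)" for n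
    by (induction n) (use s1 rec[of 1] rec in auto)
  ultimately obtain L where L: "L > 0" "(\<lambda>n. s (Suc (Suc n))) \<longlonglongrightarrow> L"
    by (intro that[of "\<Prod>j. 1 - (b (Suc j))\<^sup>2"]) simp_all
  have s_L: "s \<longlonglongrightarrow> L" using L(2) by (simp add: filterlim_sequentially_Suc[of s] filterlim_sequentially_Suc[of "\<lambda>n. s (Suc n)"])
  have "\<bar>s n - L\<bar> \<le> R * real n powr (- q)" if n: "n \<ge> 1" for n
  proof -
    have "(\<lambda>m. s (n + m)) \<longlonglongrightarrow> L" using LIMSEQ_ignore_initial_segment[OF s_L, of n] by (simp add: add.commute)
    then have "s n - L \<le> R * real n powr (- q)"
      by (intro tendsto_upperbound[OF tendsto_diff[OF tendsto_const]]) (use tail[OF n] in auto)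
    moreover have "L \<le> s n"
    proof (rule tendsto_upperbound[OF \<open>(\<lambda>m. s (n + m)) \<longlonglongrightarrow> L\<close>])
      have "s (n + m) \<le> s n" for m using n by (induction m) (auto intro: order_trans[OF dec])
      then show "\<forall>\<^sub>F m in sequentially. s (n + m) \<le> s n" by simp
    qed auto
    ultimately show ?thesis by simp
  qed
  with L(1) s_L show ?thesis by (rule that)
qed

section \<open>The Levinson--Durbin recursion\<close>

text \<open>Linear algebra only: \<open>orth\<close> and \<open>var\<close> are the normal equations
  of one-step prediction for a symmetric Toeplitz form c, and s collects the prediction error
  variances. Nondegeneracy of c comes from the positivity of s.\<close>

locale levinson =
  fixes c :: "nat \<Rightarrow> nat \<Rightarrow> real" and k :: "nat \<Rightarrow> nat \<Rightarrow> real" and s :: "nat \<Rightarrow> real"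
  assumes sym: "\<And>i j. i \<ge> 1 \<Longrightarrow> j \<ge> 1 \<Longrightarrow> c i j = c j i"
    and toeplitz: "\<And>i j. i \<ge> 1 \<Longrightarrow> j \<ge> 1 \<Longrightarrow> c (Suc i) (Suc j) = c i j"
    and diag: "\<And>n. n \<ge> 1 \<Longrightarrow> k n n = 1"
    and orth: "\<And>n j. 1 \<le> j \<Longrightarrow> j < n \<Longrightarrow> (\<Sum>i=1..n. k n i * c i j) = 0"
    and var: "\<And>n. n \<ge> 1 \<Longrightarrow> (\<Sum>i=1..n. k n i * c i n) = s n"
    and pos: "\<And>n. n \<ge> 1 \<Longrightarrow> s n > 0"
begin

lemma toeplitz_add: "i \<ge> 1 \<Longrightarrow> j \<ge> 1 \<Longrightarrow> c (i + m) (j + m) = c i j"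
  by (induction m) (simp_all add: toeplitz)

text \<open>By symmetry and Toeplitz structure \<open>c i j\<close> depends only on the distance of
  i and j, which time reversal preserves. Hence the reversed rows of k solve the backward prediction
  equations.\<close>

lemma reversed:
  assumes "1 \<le> i" "i \<le> n" "1 \<le> j" "j \<le> n"
  shows "c (n + 1 - i) (n + 1 - j) = c i j"
proof -
  have *: "c (n + 1 - i) (n + 1 - j) = c i j" if "i \<le> j" "1 \<le> i" "j \<le> n" for i j
  proof -
    have "c (n + 1 - i) (n + 1 - j) = c (Suc (j - i)) 1"
      using toeplitz_add[of "Suc (j - i)" 1 "n - j"] that by (simp add: Suc_diff_le)
    also have "\<dots> = c 1 (Suc (j - i))" by (simp add: sym)
    also have "\<dots> = c i j" using toeplitz_add[of 1 "Suc (j - i)" "i - 1"] that by simp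
    finally show ?thesis .
  qed
  show ?thesis
  proof (cases "i \<le> j")
    case True then show ?thesis using * assms by auto
  next
    case False
    then have "c (n + 1 - j) (n + 1 - i) = c j i" using *[of j i] assms by auto
    then show ?thesis using sym[of i j] sym[of "n + 1 - i" "n + 1 - j"] assms by auto
  qed
qed

text \<open>Weighting the equations with the last row of k isolates the last unknown: its factor is
  the positive variance, all other factors vanish by \<open>orth\<close>. What remains is the same
  system with one unknown fewer.\<close>

lemma nondegenerate:
  assumes "\<And>j. 1 \<le> j \<Longrightarrow> j \<le> n \<Longrightarrow> (\<Sum>i=1..n. d i * c i j) = 0"
  shows "1 \<le> i \<Longrightarrow> i \<le> n \<Longrightarrow> d i = 0"
  using assms
proof (induction n arbitrary: i)
  case 0 then show ?case by simp
next
  case (Suc n)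
  have "0 = (\<Sum>j=1..Suc n. k (Suc n) j * (\<Sum>i=1..Suc n. d i * c i j))"
    using Suc.prems(3) by simp
  also have "\<dots> = (\<Sum>i=1..Suc n. d i * (\<Sum>j=1..Suc n. k (Suc n) j * c j i))"
    unfolding sum_distrib_left
    by (subst sum.swap) (intro sum.cong refl, simp add: sym[of _ "_::nat"] mult_ac)
  also have "\<dots> = (\<Sum>i=1..Suc n. if i = Suc n then d i * s i else 0)"
    using orth[of _ "Suc n"] var[of "Suc n"] by (intro sum.cong refl) auto
  also have "\<dots> = d (Suc n) * s (Suc n)" by simp
  finally have 0: "d (Suc n) = 0" using pos[of "Suc n"] by auto
  have "(\<Sum>i=1..n. d i * c i j) = 0" if "1 \<le> j" "j \<le> n" for j
    using Suc.prems(3)[of j] that 0 by simp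
  with Suc.IH[of i] Suc.prems 0 show ?case by (cases "i = Suc n") auto
qed

text \<open>The Levinson step combines row n moved to the positions 2 to n + 1 with row n reversed
  on 1 to n. Padding both with zeros, here and in \<open>backward_sum\<close>, lets them be
  subtracted from row n + 1 over one index range.\<close>

lemma forward_shift_sum:
  assumes "n \<ge> 1" shows "(\<Sum>i=1..n+1. (if 2 \<le> i then k n (i - 1) else 0) * f i) = (\<Sum>i=1..n. k n i * f (Suc i))"
proof -
  have "(\<Sum>i=1..n+1. (if 2 \<le> i then k n (i - 1) else 0) * f i) = (\<Sum>i=2..n+1. k n (i - 1) * f i)"
    by (rule sum.mono_neutral_cong_right) auto
  also have "\<dots> = (\<Sum>i=1..n. k n i * f (Suc i))"
    by (rule sum.reindex_bij_witness[of _ Suc "\<lambda>i. i - 1"]) auto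
  finally show ?thesis .
qed

lemma backward_sum:
  "(\<Sum>i=1..n+1. (if i \<le> n then k n (n + 1 - i) else 0) * f i) = (\<Sum>i=1..n. k n i * f (n + 1 - i))"
proof -
  have "(\<Sum>i=1..n+1. (if i \<le> n then k n (n + 1 - i) else 0) * f i) = (\<Sum>i=1..n. k n (n + 1 - i) * f i)"
    by (rule sum.mono_neutral_cong_right) auto
  also have "\<dots> = (\<Sum>i=1..n. k n i * f (n + 1 - i))"
    by (rule sum.reindex_bij_witness[of _ "\<lambda>i. n + 1 - i" "\<lambda>i. n + 1 - i"]) auto
  finally show ?thesis .
qed

text \<open>Shifting the row leads to the equation at j - 1, reversing it to the one at n + 1 - j.
  Both indices lie between 1 and n - 1 exactly when 1 < j \<le> n.\<close>

lemma step_sums: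
  assumes n: "n \<ge> 1"
  shows "1 < j \<Longrightarrow> j \<le> n \<Longrightarrow> (\<Sum>i=1..n. k n i * c (Suc i) j) = 0"
    and "1 < j \<Longrightarrow> j \<le> n \<Longrightarrow> (\<Sum>i=1..n. k n i * c (n + 1 - i) j) = 0"
proof -
  assume j: "1 < j" "j \<le> n"
  have "(\<Sum>i=1..n. k n i * c (Suc i) j) = (\<Sum>i=1..n. k n i * c i (j - 1))"
    using j toeplitz[of _ "j - 1"] by (intro sum.cong refl) auto
  also have "\<dots> = 0" using orth[of "j - 1" n] j by auto
  finally show "(\<Sum>i=1..n. k n i * c (Suc i) j) = 0" .
  have "(\<Sum>i=1..n. k n i * c (n + 1 - i) j) = (\<Sum>i=1..n. k n i * c i (n + 1 - j))"
    using j reversed[of _ n "n + 1 - j"] by (intro sum.cong refl) auto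
  also have "\<dots> = 0" using orth[of "n + 1 - j" n] j by auto
  finally show "(\<Sum>i=1..n. k n i * c (n + 1 - i) j) = 0" .
qed

text \<open>The defect D of the recursion vanishes at both ends because the diagonal of k is 1, and
  it is orthogonal to all inner indices. Moved down by one index it solves the homogeneous system of
  size n - 1, so it is 0. The reflection coefficient needs no formula: it is read off as
  \<open>k (n + 1) 1\<close>.\<close>

lemma coefficients:
  assumes n: "n \<ge> 1" and i: "1 \<le> i" "i \<le> n + 1"
  shows "k (n + 1) i = (if 2 \<le> i then k n (i - 1) else 0) + k (n + 1) 1 * (if i \<le> n then k n (n + 1 - i) else 0)"
proof -
  define D where "D i = k (n + 1) i - (if 2 \<le> i then k n (i - 1) else 0)
     - k (n + 1) 1 * (if i \<le> n then k n (n + 1 - i) else 0)" for i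
  have D1: "D 1 = 0" "D (n + 1) = 0" using n diag by (auto simp: D_def)
  have sumD: "(\<Sum>i=1..n+1. D i * f i) = (\<Sum>i=1..n+1. k (n+1) i * f i) - (\<Sum>i=1..n. k n i * f (Suc i))
     - k (n + 1) 1 * (\<Sum>i=1..n. k n i * f (n + 1 - i))" for f
    unfolding forward_shift_sum[OF n, symmetric] backward_sum[symmetric] sum_distrib_left
      sum_subtractf[symmetric] D_def
    by (intro sum.cong refl) (simp add: algebra_simps)
  have D0: "(\<Sum>i=1..n+1. D i * c i j) = 0" if "1 < j" "j \<le> n" for j
    unfolding sumD using step_sums[OF n] that orth[of j "n + 1"] by simp
  have "(\<Sum>i=1..n-1. D (Suc i) * c i j) = 0" if "1 \<le> j" "j \<le> n - 1" for j
  proof -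
    have "(\<Sum>i=1..n-1. D (Suc i) * c i j) = (\<Sum>i=1..n-1. D (Suc i) * c (Suc i) (Suc j))"
      using that by (intro sum.cong refl) (auto simp: toeplitz)
    also have "\<dots> = (\<Sum>i=2..n. D i * c i (Suc j))"
      using n by (intro sum.reindex_bij_witness[of _ "\<lambda>i. i - 1" Suc]) auto
    also have "\<dots> = (\<Sum>i=1..n+1. D i * c i (Suc j))"
    proof (rule sum.mono_neutral_left)
      have "i = 1 \<or> i = n + 1" if "i \<in> {1..n+1} - {2..n}" for i using that by auto
      then show "\<forall>i\<in>{1..n + 1} - {2..n}. D i * c i (Suc j) = 0" using D1 by fastforce
    qed auto
    also have "\<dots> = 0" using D0[of "Suc j"] that by auto
    finally show ?thesis .
  qed
  from nondegenerate[of "n - 1" "\<lambda>i. D (Suc i)", OF this]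
  have "D (Suc i) = 0" if "1 \<le> i" "i \<le> n - 1" for i using that by auto
  from this[of "i - 1"] have "D i = 0" using i D1 by (cases "i = 1"; cases "i = n + 1") auto
  then show ?thesis by (simp add: D_def)
qed

text \<open>Write \<kappa> for \<open>k (n + 1) 1\<close>. After inserting the recursion, the
  equation at 1 reads 0 = t + \<kappa> s(n) and the one at n + 1 reads s(n + 1) = s(n) + \<kappa> t.
  The two cross terms are the same t by the Toeplitz symmetry, and t is eliminated.\<close>

lemma variances:
  assumes n: "n \<ge> 1" shows "s (n + 1) = s n * (1 - (k (n + 1) 1)\<^sup>2)"
proof -
  define t where "t = (\<Sum>i=1..n. k n i * c (n + 1 - i) (n + 1))"
  have e: "(\<Sum>i=1..n+1. k (n+1) i * c i j) = (\<Sum>i=1..n. k n i * c (Suc i) j)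
     + k (n + 1) 1 * (\<Sum>i=1..n. k n i * c (n + 1 - i) j)" for j
  proof -
    have "(\<Sum>i=1..n+1. k (n+1) i * c i j) = (\<Sum>i=1..n+1. (if 2 \<le> i then k n (i - 1) else 0) * c i j
        + k (n + 1) 1 * ((if i \<le> n then k n (n + 1 - i) else 0) * c i j))"
    proof (intro sum.cong refl)
      fix i assume "i \<in> {1..n+1}"
      then have "1 \<le> i" "i \<le> n + 1" by auto
      from coefficients[OF n this] show "k (n+1) i * c i j = (if 2 \<le> i then k n (i - 1) else 0) * c i j
        + k (n + 1) 1 * ((if i \<le> n then k n (n + 1 - i) else 0) * c i j)"
        by (metis distrib_right mult.assoc)
    qed
    then show ?thesis unfolding sum.distrib sum_distrib_left[symmetric]
      forward_shift_sum[OF n] backward_sum .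
  qed
  have t2: "(\<Sum>i=1..n. k n i * c (Suc i) 1) = t"
    unfolding t_def
  proof (intro sum.cong refl)
    fix i assume i: "i \<in> {1..n}"
    have "c (n + 1 - i) (n + 1) = c 1 (Suc i)" using toeplitz_add[of 1 "Suc i" "n - i"] i by (simp add: Suc_diff_le)
    then show "k n i * c (Suc i) 1 = k n i * c (n + 1 - i) (n + 1)" using sym[of 1 "Suc i"] by simp
  qed
  have s1: "(\<Sum>i=1..n. k n i * c (Suc i) (n+1)) = s n"
    unfolding var[OF n, symmetric] using n by (intro sum.cong refl) (auto simp: toeplitz)
  have s2: "(\<Sum>i=1..n. k n i * c (n + 1 - i) 1) = s n"
    unfolding var[OF n, symmetric] using n reversed[of _ n n] by (intro sum.cong refl) auto
  have "0 = t + k (n + 1) 1 * s n" using e[of 1] t2 s2 orth[of 1 "n + 1"] n by simp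
  moreover have "s (n + 1) = s n + k (n + 1) 1 * t"
    using e[of "n + 1"] s1 var[of "n + 1"] t_def by simp
  moreover have "t = - (k (n + 1) 1 * s n)" using calculation(1) by linarith
  ultimately show ?thesis by (simp add: power2_eq_square algebra_simps)
qed

end

section \<open>Matrices of spectral radius less than one\<close>

text \<open>This norm is controlled directly by entrywise bounds on matrices, and it dominates
  \<open>eucl_norm\<close>, so convergence in it suffices.\<close>

definition l1_norm :: "real vec \<Rightarrow> real" where
  "l1_norm v = (\<Sum>i<dim_vec v. \<bar>v $ i\<bar>)"

lemma l1_norm_nonneg [simp]: "l1_norm v \<ge> 0"
  by (simp add: l1_norm_def sum_nonneg)

lemma l1_norm_triangle:
  assumes "v \<in> carrier_vec p" "w \<in> carrier_vec p"
  shows "l1_norm (v + w) \<le> l1_norm v + l1_norm w"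
proof -
  have "l1_norm (v + w) = (\<Sum>i<p. \<bar>v $ i + w $ i\<bar>)"
    using assms by (simp add: l1_norm_def)
  also have "\<dots> \<le> (\<Sum>i<p. \<bar>v $ i\<bar> + \<bar>w $ i\<bar>)"
    by (intro sum_mono abs_triangle_ineq)
  finally show ?thesis using assms by (simp add: l1_norm_def sum.distrib)
qed

lemma l1_norm_smult: "l1_norm (c \<cdot>\<^sub>v v) = \<bar>c\<bar> * l1_norm v"
  by (simp add: l1_norm_def abs_mult sum_distrib_left)

lemma l1_norm_unit_vec: "0 < p \<Longrightarrow> l1_norm (unit_vec p 0) = 1"
  by (simp add: l1_norm_def unit_vec_def if_distrib[of abs] sum.delta cong: if_cong)

lemma eucl_norm_le_l1_norm: "eucl_norm v \<le> l1_norm v"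
  using L2_set_le_sum_abs[of "\<lambda>i. v $ i" "{..<dim_vec v}"]
  by (simp add: eucl_norm_def l1_norm_def L2_set_def)

lemma abs_index_le_l1_norm: "i < dim_vec v \<Longrightarrow> \<bar>v $ i\<bar> \<le> l1_norm v"
  unfolding l1_norm_def by (rule member_le_sum) auto

lemma eigenvalue_smult_iff:
  fixes A :: "'a::field mat"
  assumes A: "A \<in> carrier_mat n n" and a: "a \<noteq> 0"
  shows "eigenvalue (a \<cdot>\<^sub>m A) (a * x) \<longleftrightarrow> eigenvalue A x"
proof -
  have "(a \<cdot>\<^sub>m A) *\<^sub>v v = (a * x) \<cdot>\<^sub>v v \<longleftrightarrow> A *\<^sub>v v = x \<cdot>\<^sub>v v" if "v \<in> carrier_vec n" for v
  proof -
    have "(a \<cdot>\<^sub>m A) *\<^sub>v v = a \<cdot>\<^sub>v (A *\<^sub>v v)" using A that by auto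
    moreover have "(a * x) \<cdot>\<^sub>v v = a \<cdot>\<^sub>v (x \<cdot>\<^sub>v v)" by (simp add: smult_smult_assoc)
    moreover have "a \<cdot>\<^sub>v y = a \<cdot>\<^sub>v z \<longleftrightarrow> y = z" for y z :: "'a vec"
      using a by (auto simp: vec_eq_iff)
    ultimately show ?thesis by simp
  qed
  then show ?thesis using A by (auto simp: eigenvalue_def eigenvector_def)
qed

lemma spectral_radius_smult:
  assumes A: "A \<in> carrier_mat n n" and n: "n > 0" and a: "a \<noteq> 0"
  shows "spectral_radius (a \<cdot>\<^sub>m A) = norm a * spectral_radius A"
proof -
  have "spectrum (a \<cdot>\<^sub>m A) = (\<lambda>x. a * x) ` spectrum A"
  proof (rule Set.set_eqI)
    fix y
    have "y \<in> spectrum (a \<cdot>\<^sub>m A) \<longleftrightarrow> y / a \<in> spectrum A"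
      using eigenvalue_smult_iff[OF A a, of "y / a"] a by (simp add: spectrum_def)
    then show "y \<in> spectrum (a \<cdot>\<^sub>m A) \<longleftrightarrow> y \<in> (\<lambda>x. a * x) ` spectrum A"
      using a by (auto intro!: image_eqI[of _ _ "y / a"])
  qed
  then have "norm ` spectrum (a \<cdot>\<^sub>m A) = (\<lambda>x. norm a * x) ` (norm ` spectrum A)"
    by (simp add: image_image norm_mult)
  moreover have "Max ((\<lambda>x. norm a * x) ` (norm ` spectrum A)) = norm a * Max (norm ` spectrum A)"
    using card_finite_spectrum(1)[OF A] spectrum_non_empty[OF A n]
    by (intro mono_Max_commute[symmetric]) (auto simp: mono_def mult_left_mono)
  ultimately show ?thesis by (simp add: spectral_radius_def)
qed

lemma smult_smult_mat: "a \<cdot>\<^sub>m (b \<cdot>\<^sub>m A) = (a * b :: 'a::semigroup_mult) \<cdot>\<^sub>m A"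
  by (intro eq_matI) (auto simp: mult.assoc)

lemma power_smult_mat:
  fixes A :: "'a::comm_semiring_1 mat"
  assumes A: "A \<in> carrier_mat n n"
  shows "(a \<cdot>\<^sub>m A) ^\<^sub>m k = a ^ k \<cdot>\<^sub>m (A ^\<^sub>m k)"
proof (induction k)
  case (Suc k)
  have "A ^\<^sub>m k \<in> carrier_mat n n" using A by simp
  then show ?case using Suc A by (simp add: mult_smult_assoc_mat[of _ n n _ n] mult_smult_distrib[of _ n n _ n] smult_smult_mat mult.commute)
qed (use A in \<open>auto intro!: eq_matI\<close>)

text \<open>The Jordan form bounds the powers of a matrix of spectral radius below 1 by a constant.
  Applied to A / t, whose spectral radius is still below 1, this becomes decay of order t^k for
  A.\<close>

lemma stable_matrix_power_bound:
  fixes A :: "real mat"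
  assumes A: "A \<in> carrier_mat p p" and p: "p > 0"
    and stable: "spectral_radius (map_mat complex_of_real A) < 1"
  obtains c t where "0 < t" "t < 1" "c \<ge> 0"
    "\<And>k v. v \<in> carrier_vec p \<Longrightarrow> l1_norm (A ^\<^sub>m k *\<^sub>v v) \<le> c * t ^ k * l1_norm v"
proof -
  let ?A = "map_mat complex_of_real A"
  have cA: "?A \<in> carrier_mat p p" using A by simp
  have "spectral_radius ?A \<ge> 0"
    using spectral_radius_mem_max(1)[OF cA p] by auto
  \<comment> \<open>The midpoint between the spectral radius and 1. It is at least 1/2, so dividing
    by it is possible even for nilpotent A.\<close>
  define t where "t = (spectral_radius ?A + 1) / 2"
  have t: "0 < t" "t < 1" "spectral_radius ?A < t" using stable \<open>spectral_radius ?A \<ge> 0\<close> by (auto simp: t_def)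
  have "spectral_radius (complex_of_real (1 / t) \<cdot>\<^sub>m ?A) = norm (complex_of_real (1 / t)) * spectral_radius ?A"
    using t by (intro spectral_radius_smult[OF cA p]) auto
  also have "\<dots> < 1" using t by (simp add: norm_divide)
  finally obtain c where c: "\<And>k. norm_bound ((complex_of_real (1 / t) \<cdot>\<^sub>m ?A) ^\<^sub>m k) c"
    using spectral_radius_jnf_norm_bound_less_1_upper_triangular[of "complex_of_real (1 / t) \<cdot>\<^sub>m ?A" p] cA by auto
  have entry: "\<bar>(A ^\<^sub>m k) $$ (i, j)\<bar> \<le> \<bar>c\<bar> * t ^ k" if ij: "i < p" "j < p" for k i j
  proof -
    have Ak: "A ^\<^sub>m k \<in> carrier_mat p p" using A by simp
    have eq: "(complex_of_real (1 / t) \<cdot>\<^sub>m ?A) ^\<^sub>m k = complex_of_real (1 / t) ^ k \<cdot>\<^sub>m map_mat complex_of_real (A ^\<^sub>m k)"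
      by (simp only: power_smult_mat[OF cA] of_real_hom.mat_hom_pow[OF A])
    have "norm (((complex_of_real (1 / t) \<cdot>\<^sub>m ?A) ^\<^sub>m k) $$ (i, j)) \<le> c"
      using c[of k] ij carrier_matD[OF Ak] unfolding norm_bound_def eq by (simp only: index_smult_mat(2,3) index_map_mat(2,3))
    then have "norm (complex_of_real (1 / t) ^ k * complex_of_real ((A ^\<^sub>m k) $$ (i, j))) \<le> c"
      unfolding eq using ij carrier_matD[OF Ak] by (simp only: index_smult_mat index_map_mat)
    then have "(1 / t) ^ k * \<bar>(A ^\<^sub>m k) $$ (i, j)\<bar> \<le> c"
      using t by (simp only: norm_mult norm_power norm_of_real) simp
    then have "((1 / t) ^ k * \<bar>(A ^\<^sub>m k) $$ (i, j)\<bar>) * t ^ k \<le> c * t ^ k"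
      using t by (intro mult_right_mono) auto
    then have "\<bar>(A ^\<^sub>m k) $$ (i, j)\<bar> \<le> c * t ^ k"
      using t by (simp add: power_one_over)
    also have "\<dots> \<le> \<bar>c\<bar> * t ^ k" using t by (intro mult_right_mono) auto
    finally show ?thesis .
  qed
  have "l1_norm (B *\<^sub>v v) \<le> (real p * d) * l1_norm v"
    if B: "B \<in> carrier_mat p p" and d: "\<And>i j. i < p \<Longrightarrow> j < p \<Longrightarrow> \<bar>B $$ (i, j)\<bar> \<le> d" and v: "v \<in> carrier_vec p"
    for B :: "real mat" and d v
  proof -
    have "\<bar>(B *\<^sub>v v) $ i\<bar> \<le> d * l1_norm v" if i: "i < p" for i
    proof -
      have "(B *\<^sub>v v) $ i = (\<Sum>j<p. B $$ (i, j) * v $ j)"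
        using B i v by (simp add: scalar_prod_def lessThan_atLeast0)
      also have "\<bar>\<dots>\<bar> \<le> (\<Sum>j<p. \<bar>B $$ (i, j)\<bar> * \<bar>v $ j\<bar>)"
        using sum_abs[of "\<lambda>j. B $$ (i, j) * v $ j" "{..<p}"] by (simp only: abs_mult)
      also have "\<dots> \<le> (\<Sum>j<p. d * \<bar>v $ j\<bar>)"
        by (intro sum_mono mult_right_mono d i) simp_all
      also have "\<dots> = d * l1_norm v" using v by (simp add: l1_norm_def sum_distrib_left)
      finally show ?thesis .
    qed
    then have "l1_norm (B *\<^sub>v v) \<le> (\<Sum>i<p. d * l1_norm v)"
      unfolding l1_norm_def[of "B *\<^sub>v v"] dim_mult_mat_vec carrier_matD(1)[OF B] by (intro sum_mono) simp
    then show ?thesis by simp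
  qed
  from this[OF pow_carrier_mat[OF A] entry]
  have bound: "l1_norm (A ^\<^sub>m k *\<^sub>v v) \<le> (real p * \<bar>c\<bar>) * t ^ k * l1_norm v" if "v \<in> carrier_vec p" for k v
    using that unfolding mult.assoc by blast
  show ?thesis by (rule that[OF t(1,2) _ bound]) simp_all
qed

text \<open>As c may exceed 1, chaining the norms of successive x would cost a factor c at every
  step. The majorant y contracts by exactly t, and c is paid only once.\<close>

lemma affine_rec_norm_bound:
  fixes A :: "real mat" and x u :: "nat \<Rightarrow> real vec"
  assumes A: "A \<in> carrier_mat p p" and c: "c \<ge> 0"
    and bound: "\<And>k v. v \<in> carrier_vec p \<Longrightarrow> l1_norm (A ^\<^sub>m k *\<^sub>v v) \<le> c * t ^ k * l1_norm v"
    and x: "\<And>n. x n \<in> carrier_vec p" and u: "\<And>n. u n \<in> carrier_vec p"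
    and rec: "\<And>n. x (Suc n) = A *\<^sub>v x n + u n"
    and y0: "l1_norm (x 0) \<le> y 0" and t: "t \<ge> 0"
    and y: "\<And>n. y (Suc n) = t * y n + l1_norm (u n)"
  shows "l1_norm (x n) \<le> c * y n"
proof -
  \<comment> \<open>Stated for all powers k: the homogeneous part of the next term raises the power
    by one instead of costing another c.\<close>
  have "l1_norm (A ^\<^sub>m k *\<^sub>v x n) \<le> c * t ^ k * y n" for k
  proof (induction n arbitrary: k)
    case 0
    have "c * t ^ k * l1_norm (x 0) \<le> c * t ^ k * y 0" using y0 c t by (intro mult_left_mono) auto
    with bound[OF x, of k 0] show ?case by linarith
  next
    case (Suc n)
    have Ak: "A ^\<^sub>m k \<in> carrier_mat p p" using A by simp
    have "A ^\<^sub>m k *\<^sub>v x (Suc n) = A ^\<^sub>m Suc k *\<^sub>v x n + A ^\<^sub>m k *\<^sub>v u n"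
      unfolding rec using A Ak x[of n] u[of n]
      by (simp add: mult_add_distrib_mat_vec[OF Ak] assoc_mult_mat_vec[OF Ak A])
    then have "l1_norm (A ^\<^sub>m k *\<^sub>v x (Suc n)) \<le> l1_norm (A ^\<^sub>m Suc k *\<^sub>v x n) + l1_norm (A ^\<^sub>m k *\<^sub>v u n)"
      using l1_norm_triangle[OF mult_mat_vec_carrier[OF pow_carrier_mat[OF A, of "Suc k"] x[of n]]
          mult_mat_vec_carrier[OF Ak u[of n]]] by (simp only:)
    also have "\<dots> \<le> c * t ^ Suc k * y n + c * t ^ k * l1_norm (u n)"
      by (intro add_mono Suc bound u)
    also have "\<dots> = c * t ^ k * y (Suc n)" by (simp add: y algebra_simps)
    finally show ?case .
  qed
  from this[of 0] show ?thesis using A x[of n] by simp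
qed

section \<open>The recursion of the transformed autoregression\<close>

lemma companion_carrier [simp]: "companion p \<theta> \<in> carrier_mat p p"
  by (simp add: companion_def)

lemma ar_Y_Suc:
  assumes "j < p"
  shows "ar_Y p \<theta> x (Suc n) $ j = (companion p \<theta> *\<^sub>v ar_Y p \<theta> x n) $ j + (if j = 0 then x (Suc n) else 0)"
proof -
  have row: "(companion p \<theta> *\<^sub>v ar_Y p \<theta> x n) $ j =
      (\<Sum>i<p. (if j = 0 then \<theta> (i + 1) else if j = i + 1 then 1 else 0) * ar_X p \<theta> x (n - i))"
    using assms by (simp add: companion_def ar_Y_def scalar_prod_def lessThan_atLeast0)
  show ?thesis
  proof (cases "j = 0")
    case True
    have "(\<Sum>i<p. \<theta> (i + 1) * ar_X p \<theta> x (n - i)) = (\<Sum>i=1..p. \<theta> i * ar_X p \<theta> x (Suc n - i))"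
      by (rule sum.reindex_bij_witness[of _ "\<lambda>i. i - 1" Suc]) auto
    then show ?thesis using row True assms by (simp add: ar_Y_def)
  next
    case False
    have "(\<Sum>i<p. (if j = i + 1 then 1 else 0) * ar_X p \<theta> x (n - i)) = (\<Sum>i<p. if i = j - 1 then ar_X p \<theta> x (n - i) else 0)"
      using False by (intro sum.cong) auto
    also have "\<dots> = ar_X p \<theta> x (n - (j - 1))" using assms False by (simp add: sum.delta less_imp_diff_less)
    finally show ?thesis using row False assms by (simp add: ar_Y_def)
  qed
qed

text \<open>The second block of \<open>ar_zeta\<close> for n \<ge> 1; it is 0 at n = 1, where the
  sum is empty.\<close>

definition ar_W :: "nat \<Rightarrow> (nat \<Rightarrow> real) \<Rightarrow> (nat \<Rightarrow> nat \<Rightarrow> real) \<Rightarrow> (nat \<Rightarrow> real) \<Rightarrow> nat \<Rightarrow> real vec" where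
  "ar_W p \<theta> k x n = vec p (\<lambda>j. \<Sum>m=1..<n. pacf k m * ar_Z p \<theta> k x m $ j)"

lemma ar_Y_carrier [simp]: "ar_Y p \<theta> x n \<in> carrier_vec p" by (simp add: ar_Y_def)
lemma ar_Z_carrier [simp]: "ar_Z p \<theta> k x n \<in> carrier_vec p" by (simp add: ar_Z_def)
lemma ar_W_carrier [simp]: "ar_W p \<theta> k x n \<in> carrier_vec p" by (simp add: ar_W_def)

lemma ar_W_Suc: "n \<ge> 1 \<Longrightarrow> ar_W p \<theta> k x (Suc n) = ar_W p \<theta> k x n + pacf k n \<cdot>\<^sub>v ar_Z p \<theta> k x n"
  by (intro eq_vecI) (auto simp: ar_W_def ar_Z_def)

lemma vec_first_ar_zeta: "n \<ge> 1 \<Longrightarrow> vec_first (ar_zeta p \<theta> k x n) p = ar_Z p \<theta> k x n"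
  by (auto simp: ar_zeta_def vec_first_def ar_Z_def intro!: eq_vecI)

lemma mat_vec_sum_index:
  fixes A :: "real mat"
  assumes "A \<in> carrier_mat p p" "j < p" "\<And>i. v i \<in> carrier_vec p"
  shows "(A *\<^sub>v vec p (\<lambda>l. \<Sum>i\<in>I. c i * v i $ l)) $ j = (\<Sum>i\<in>I. c i * (A *\<^sub>v v i) $ j)"
proof -
  have "(A *\<^sub>v vec p (\<lambda>l. \<Sum>i\<in>I. c i * v i $ l)) $ j = (\<Sum>l<p. \<Sum>i\<in>I. c i * (A $$ (j, l) * v i $ l))"
    using assms by (simp add: scalar_prod_def lessThan_atLeast0 sum_distrib_left mult_ac)
  also have "\<dots> = (\<Sum>i\<in>I. c i * (\<Sum>l<p. A $$ (j, l) * v i $ l))"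
    by (subst sum.swap) (simp add: sum_distrib_left)
  also have "\<dots> = (\<Sum>i\<in>I. c i * (A *\<^sub>v v i) $ j)"
    using assms(1,2) carrier_vecD[OF assms(3)] by (simp add: scalar_prod_def lessThan_atLeast0)
  finally show ?thesis .
qed

context levinson
begin

lemma coefficients_Suc:
  assumes "n \<ge> 1" "1 \<le> i" "i \<le> n"
  shows "k (Suc n) (Suc i) = k n i - pacf k n * (if i < n then k n (n - i) else 0)"
  using coefficients[of n "Suc i"] assms by (auto simp: pacf_def)

lemma coefficients_rev_Suc:
  assumes "n \<ge> 1" "1 \<le> i" "i \<le> n"
  shows "k (Suc n) (Suc n - i) = (if i < n then k n (n - i) else 0) - pacf k n * k n i"
  using coefficients[of n "Suc n - i"] assms by (auto simp: pacf_def)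

text \<open>With an additional term i = 0, of weight \<open>k n n = 1\<close> and with zero vector
  \<open>ar_Y p \<theta> x 0\<close>, the sum is the backward prediction filter that predicts time 0
  from the times 1 to n - 1. By Levinson the next filter differs by -\<beta>(n) times row n, which
  is what the new summand \<beta>(n) Z(n) of W contributes after the change of sign.\<close>

lemma ar_W_eq:
  assumes "n \<ge> 1" "j < p"
  shows "ar_W p \<theta> k x n $ j = - (\<Sum>i=1..<n. k n (n - i) * ar_Y p \<theta> x i $ j)"
  using assms(1)
proof (induction n rule: dec_induct)
  case base
  then show ?case using assms by (simp add: ar_W_def)
next
  case (step n)
  then have n: "n \<ge> 1" by simp
  have "(\<Sum>i=1..<Suc n. k (Suc n) (Suc n - i) * ar_Y p \<theta> x i $ j) =
    (\<Sum>i=1..<Suc n. ((if i < n then k n (n - i) else 0) - pacf k n * k n i) * ar_Y p \<theta> x i $ j)"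
    by (intro sum.cong refl, subst coefficients_rev_Suc[OF n]) auto
  also have "\<dots> = (\<Sum>i=1..<n. k n (n - i) * ar_Y p \<theta> x i $ j) - pacf k n * (\<Sum>i=1..n. k n i * ar_Y p \<theta> x i $ j)"
    using n by (simp add: left_diff_distrib sum_subtractf sum_distrib_left mult.assoc distrib_left atLeastLessThanSuc_atLeastAtMost[symmetric])
  finally show ?case using step.IH n assms(2) by (simp add: ar_W_Suc ar_Z_def ar_W_def)
qed

text \<open>Each \<open>ar_Y\<close> is replaced by its companion recursion. The scalar inputs
  reassemble into the filtered noise; the coefficients of the matrix terms, whose index is raised by
  one, split by Levinson into row n, which gives Z, and the reversed row, which gives \<beta>(n) W
  by \<open>ar_W_eq\<close>.\<close>

lemma ar_Z_Suc:
  assumes n: "n \<ge> 1" and p: "p \<ge> 1"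
  shows "ar_Z p \<theta> k x (Suc n) = companion p \<theta> *\<^sub>v ar_Z p \<theta> k x n +
    (pacf k n \<cdot>\<^sub>v (companion p \<theta> *\<^sub>v ar_W p \<theta> k x n) + (\<Sum>i=1..Suc n. k (Suc n) i * x i) \<cdot>\<^sub>v unit_vec p 0)"
proof (intro eq_vecI)
  let ?A = "companion p \<theta>" and ?Y = "ar_Y p \<theta> x"
  fix j assume "j < dim_vec (?A *\<^sub>v ar_Z p \<theta> k x n +
    (pacf k n \<cdot>\<^sub>v (?A *\<^sub>v ar_W p \<theta> k x n) + (\<Sum>i=1..Suc n. k (Suc n) i * x i) \<cdot>\<^sub>v unit_vec p 0))"
  then have j: "j < p" by simp
  have "ar_Z p \<theta> k x (Suc n) $ j = (\<Sum>i=1..Suc n. k (Suc n) i * (?A *\<^sub>v ?Y (i - 1)) $ j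
      + (if j = 0 then k (Suc n) i * x i else 0))"
  proof -
    have "ar_Z p \<theta> k x (Suc n) $ j = (\<Sum>i=1..Suc n. k (Suc n) i * ?Y i $ j)" using j by (simp add: ar_Z_def)
    also have "\<dots> = (\<Sum>i=1..Suc n. k (Suc n) i * (?A *\<^sub>v ?Y (i - 1)) $ j
      + (if j = 0 then k (Suc n) i * x i else 0))"
    proof (intro sum.cong refl)
      fix i assume "i \<in> {1..Suc n}"
      then obtain m where "i = Suc m" by (cases i) auto
      with ar_Y_Suc[OF j, of \<theta> x m] show "k (Suc n) i * ?Y i $ j = k (Suc n) i * (?A *\<^sub>v ?Y (i - 1)) $ j + (if j = 0 then k (Suc n) i * x i else 0)"
        by (simp add: algebra_simps)
    qed
    finally show ?thesis .
  qed
  also have "\<dots> = (\<Sum>i=1..Suc n. k (Suc n) i * (?A *\<^sub>v ?Y (i - 1)) $ j) + (if j = 0 then (\<Sum>i=1..Suc n. k (Suc n) i * x i) else 0)"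
    by (simp add: sum.distrib)
  also have "(\<Sum>i=1..Suc n. k (Suc n) i * (?A *\<^sub>v ?Y (i - 1)) $ j) = (\<Sum>i=0..n. k (Suc n) (Suc i) * (?A *\<^sub>v ?Y i) $ j)"
    by (rule sum.reindex_bij_witness[of _ Suc "\<lambda>i. i - 1"]) auto
  also have "\<dots> = (\<Sum>i=1..n. k (Suc n) (Suc i) * (?A *\<^sub>v ?Y i) $ j)"
  proof -
    have "?Y 0 = 0\<^sub>v p" by (intro eq_vecI) (auto simp: ar_Y_def)
    then have "(?A *\<^sub>v ?Y 0) $ j = 0" using j by (simp add: scalar_prod_def companion_def)
    then show ?thesis by (simp add: sum.atLeast_Suc_atMost)
  qed
  also have "\<dots> = (\<Sum>i=1..n. (k n i - pacf k n * (if i < n then k n (n - i) else 0)) * (?A *\<^sub>v ?Y i) $ j)"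
    by (intro sum.cong refl, subst coefficients_Suc[OF n]) auto
  also have "\<dots> = (\<Sum>i=1..n. k n i * (?A *\<^sub>v ?Y i) $ j) + pacf k n * (\<Sum>i=1..<n. - k n (n - i) * (?A *\<^sub>v ?Y i) $ j)"
    using n by (simp add: left_diff_distrib sum_subtractf sum_distrib_left mult.assoc atLeastLessThanSuc_atLeastAtMost[symmetric] sum_negf)
  also have "(\<Sum>i=1..n. k n i * (?A *\<^sub>v ?Y i) $ j) = (?A *\<^sub>v ar_Z p \<theta> k x n) $ j"
    unfolding ar_Z_def using j by (intro mat_vec_sum_index[symmetric]) auto
  also have "(\<Sum>i=1..<n. - k n (n - i) * (?A *\<^sub>v ?Y i) $ j) = (?A *\<^sub>v ar_W p \<theta> k x n) $ j"
  proof -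
    have "ar_W p \<theta> k x n = vec p (\<lambda>j. \<Sum>i=1..<n. - k n (n - i) * ?Y i $ j)"
      by (intro eq_vecI) (simp_all add: ar_W_eq[OF n] sum_negf carrier_vecD[OF ar_W_carrier])
    then show ?thesis using j by (subst mat_vec_sum_index[symmetric]) auto
  qed
  finally show "ar_Z p \<theta> k x (Suc n) $ j = (?A *\<^sub>v ar_Z p \<theta> k x n +
    (pacf k n \<cdot>\<^sub>v (?A *\<^sub>v ar_W p \<theta> k x n) + (\<Sum>i=1..Suc n. k (Suc n) i * x i) \<cdot>\<^sub>v unit_vec p 0)) $ j"
    using j by (simp add: unit_vec_def carrier_matD[OF companion_carrier])
qed (simp add: ar_Z_def)

end

section \<open>The innovations\<close>

text \<open>A moment of high order j makes the rescaled powers \<open>X n\<close> summable in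
  expectation. Their sum is then almost surely finite and bounds every single term.\<close>

lemma (in prob_space) std_normal_sequence_growth:
  fixes \<epsilon> :: "nat \<Rightarrow> 'a \<Rightarrow> real"
  assumes normal: "\<And>n. distributed M lborel (\<epsilon> n) std_normal_density" and \<delta>: "\<delta> > 0"
  shows "AE \<omega> in M. \<exists>G. \<forall>n. \<bar>\<epsilon> n \<omega>\<bar> \<le> G * (real n + 1) powr \<delta>"
proof -
  \<comment> \<open>The order of the moment: j \<delta> \<ge> 2 makes the expectations summable like
    inverse squares.\<close>
  obtain j :: nat where j: "real j * \<delta> \<ge> 2" "j \<ge> 1"
  proof
    have "2 \<le> 2 / \<delta> * \<delta>" using \<delta> by simp
    also have "\<dots> \<le> real (Suc (nat \<lceil>2 / \<delta>\<rceil>)) * \<delta>" using \<delta> by (intro mult_right_mono) linarith+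
    finally show "real (Suc (nat \<lceil>2 / \<delta>\<rceil>)) * \<delta> \<ge> 2" .
  qed simp
  have meas[measurable]: "\<epsilon> n \<in> borel_measurable M" for n
    using distributed_measurable[OF normal] by simp
  define m where "m = (\<integral>x. std_normal_density x * \<bar>x\<bar> ^ j \<partial>lborel)"
  have int: "integrable M (\<lambda>\<omega>. \<bar>\<epsilon> n \<omega>\<bar> ^ j)" for n
    using distributed_integrable[OF normal, of "\<lambda>x. \<bar>x\<bar> ^ j" n] integrable_std_normal_moment_abs[of j] by simp
  have E: "(\<integral>\<omega>. \<bar>\<epsilon> n \<omega>\<bar> ^ j \<partial>M) = m" for n
    using distributed_integral[OF normal, of "\<lambda>x. \<bar>x\<bar> ^ j" n] by (simp add: m_def)
  have m0: "m \<ge> 0" unfolding m_def by (intro integral_nonneg_AE) auto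
  define X where "X n \<omega> = (\<bar>\<epsilon> n \<omega>\<bar> / (real n + 1) powr \<delta>) ^ j" for n \<omega>
  have [measurable]: "X n \<in> borel_measurable M" for n unfolding X_def[abs_def] by measurable
  have EX: "(\<integral>\<^sup>+\<omega>. ennreal (X n \<omega>) \<partial>M) \<le> ennreal (m * (1 / real (Suc n)^2))" for n
  proof -
    have "(\<integral>\<^sup>+\<omega>. ennreal (X n \<omega>) \<partial>M) = ennreal (\<integral>\<omega>. X n \<omega> \<partial>M)"
      unfolding X_def using int by (intro nn_integral_eq_integral) (auto simp: power_divide)
    also have "(\<integral>\<omega>. X n \<omega> \<partial>M) = m / ((real n + 1) powr \<delta>) ^ j"
      unfolding X_def by (simp add: power_divide E)
    also have "((real n + 1) powr \<delta>) ^ j = (real n + 1) powr (real j * \<delta>)"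
      by (simp add: powr_realpow[symmetric] powr_powr mult.commute)
    also have "m / (real n + 1) powr (real j * \<delta>) \<le> m / (real n + 1) powr 2"
      using m0 j by (intro divide_left_mono powr_mono mult_pos_pos) auto
    also have "(real n + 1) powr 2 = real (Suc n)^2" by (simp add: add.commute)
    finally show ?thesis using m0 by (simp add: ennreal_leI)
  qed
  have "summable (\<lambda>n. m * (1 / real (Suc n)^2))"
    using inverse_power_summable[of 2, where 'a=real]
    by (intro summable_mult) (simp add: summable_Suc_iff[of "\<lambda>n. 1 / (real n)\<^sup>2"] inverse_eq_divide del: of_nat_Suc)
  then have "(\<Sum>n. ennreal (m * (1 / real (Suc n)^2))) \<noteq> \<top>"
    using m0 by (intro ennreal_suminf_neq_top) auto
  then have "(\<Sum>n. \<integral>\<^sup>+\<omega>. ennreal (X n \<omega>) \<partial>M) \<noteq> \<top>"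
    using suminf_le[of "\<lambda>n. \<integral>\<^sup>+\<omega>. ennreal (X n \<omega>) \<partial>M", OF EX summableI summableI]
    by (metis top_unique)
  then have "(\<integral>\<^sup>+\<omega>. (\<Sum>n. ennreal (X n \<omega>)) \<partial>M) \<noteq> \<infinity>"
    by (subst nn_integral_suminf) auto
  then have "AE \<omega> in M. (\<Sum>n. ennreal (X n \<omega>)) \<noteq> \<infinity>"
    by (intro nn_integral_PInf_AE) auto
  then show ?thesis
  proof eventually_elim
    case (elim \<omega>)
    then obtain S where S: "S \<ge> 0" "(\<Sum>n. ennreal (X n \<omega>)) = ennreal S"
      by (metis ennreal_cases infinity_ennreal_def)
    have "\<bar>\<epsilon> n \<omega>\<bar> \<le> (1 + S) * (real n + 1) powr \<delta>" for n
    proof -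
      let ?q = "\<bar>\<epsilon> n \<omega>\<bar> / (real n + 1) powr \<delta>"
      have "ennreal (X n \<omega>) \<le> (\<Sum>n. ennreal (X n \<omega>))"
        using sum_le_suminf[OF summableI, of "{n}" "\<lambda>n. ennreal (X n \<omega>)"] by simp
      then have XS: "?q ^ j \<le> S" using S by (simp add: X_def)
      \<comment> \<open>The summand 1 avoids a j-th root: a quotient above 1 is at most its j-th
        power, hence at most S.\<close>
      have "?q \<le> 1 + S"
      proof (cases "?q \<le> 1")
        case True then show ?thesis using S by linarith
      next
        case False
        then have "?q ^ 1 \<le> ?q ^ j" using j by (intro power_increasing) auto
        then show ?thesis using XS by simp
      qed
      then show ?thesis by (simp add: divide_le_eq)
    qed
    then show ?case by blast
  qed
qed

section \<open>Second moments of the noise and the innovations\<close>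

definition square_integrable :: "'w measure \<Rightarrow> ('w \<Rightarrow> real) \<Rightarrow> bool" where
  "square_integrable M f \<longleftrightarrow> f \<in> borel_measurable M \<and> integrable M (\<lambda>x. (f x)\<^sup>2)"

lemma square_integrable_mult:
  assumes "square_integrable M f" "square_integrable M g"
  shows "integrable M (\<lambda>x. f x * g x)"
proof (rule Bochner_Integration.integrable_bound)
  show "integrable M (\<lambda>x. (f x)\<^sup>2 + (g x)\<^sup>2)" using assms by (simp add: square_integrable_def)
  show "(\<lambda>x. f x * g x) \<in> borel_measurable M" using assms by (auto simp: square_integrable_def)
  have "\<bar>a * b\<bar> \<le> a\<^sup>2 + b\<^sup>2" for a b :: real
    using sum_squares_bound[of "\<bar>a\<bar>" "\<bar>b\<bar>"] mult_nonneg_nonneg[of "\<bar>a\<bar>" "\<bar>b\<bar>"]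
    by (simp add: abs_mult del: mult_nonneg_nonneg)
  then show "AE x in M. norm (f x * g x) \<le> norm ((f x)\<^sup>2 + (g x)\<^sup>2)" by auto
qed

lemma square_integrable_cmult: "square_integrable M f \<Longrightarrow> square_integrable M (\<lambda>x. c * f x)"
  by (auto simp: square_integrable_def power_mult_distrib)

lemma square_integrable_add:
  assumes "square_integrable M f" "square_integrable M g"
  shows "square_integrable M (\<lambda>x. f x + g x)"
  using assms square_integrable_mult[OF assms]
  by (auto simp: square_integrable_def power2_sum mult.assoc)

lemma square_integrable_sum:
  assumes "finite I" "\<And>i. i \<in> I \<Longrightarrow> square_integrable M (f i)"
  shows "square_integrable M (\<lambda>x. \<Sum>i\<in>I. f i x)"
  using assms by (induction I rule: finite_induct) (auto simp: square_integrable_add, simp add: square_integrable_def)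

lemma square_integrable_cong_AE:
  assumes "square_integrable M f" "g \<in> borel_measurable M" "AE x in M. g x = f x"
  shows "square_integrable M g"
proof -
  have "AE x in M. (g x)\<^sup>2 = (f x)\<^sup>2" using assms(3) by eventually_elim simp
  then show ?thesis
    using assms(1,2) integrable_cong_AE[of "\<lambda>x. (g x)\<^sup>2" M "\<lambda>x. (f x)\<^sup>2"] by (auto simp: square_integrable_def)
qed

lemma (in prob_space) std_normal_indep_moments:
  fixes \<epsilon> :: "nat \<Rightarrow> 'a \<Rightarrow> real"
  assumes indep: "indep_vars (\<lambda>_. borel) \<epsilon> {1..}"
    and normal: "\<And>n. n \<ge> 1 \<Longrightarrow> distributed M lborel (\<epsilon> n) std_normal_density"
  shows "n \<ge> 1 \<Longrightarrow> square_integrable M (\<epsilon> n)"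
    and "m \<ge> 1 \<Longrightarrow> n \<ge> 1 \<Longrightarrow> expectation (\<lambda>\<omega>. \<epsilon> m \<omega> * \<epsilon> n \<omega>) = (if m = n then 1 else 0)"
proof -
  have meas: "\<epsilon> n \<in> borel_measurable M" if "n \<ge> 1" for n
    using distributed_measurable[OF normal[OF that]] by simp
  have int: "integrable M (\<lambda>\<omega>. \<epsilon> n \<omega> ^ j)" if "n \<ge> 1" for n j
    using distributed_integrable[OF normal[OF that], of "\<lambda>x. x ^ j"] integrable_std_normal_moment[of j] by simp
  show "square_integrable M (\<epsilon> n)" if "n \<ge> 1" for n
    using meas[OF that] int[OF that] by (simp add: square_integrable_def)
  have E1: "expectation (\<epsilon> n) = 0" if "n \<ge> 1" for n
    using distributed_integral[OF normal[OF that], of "\<lambda>x. x"] integral_std_normal_moment_odd[of 0] by simp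
  have E2: "expectation (\<lambda>\<omega>. (\<epsilon> n \<omega>)\<^sup>2) = 1" if "n \<ge> 1" for n
    using distributed_integral[OF normal[OF that], of "\<lambda>x. x\<^sup>2"] integral_std_normal_moment_even[of 1] by simp
  show "expectation (\<lambda>\<omega>. \<epsilon> m \<omega> * \<epsilon> n \<omega>) = (if m = n then 1 else 0)" if mn: "m \<ge> 1" "n \<ge> 1" for m n
  proof (cases "m = n")
    case True then show ?thesis using E2 mn by (simp add: power2_eq_square)
  next
    case False
    have "indep_vars (\<lambda>_. borel) \<epsilon> {m, n}" using mn by (intro indep_vars_subset[OF indep]) auto
    then have "expectation (\<lambda>\<omega>. \<Prod>i\<in>{m, n}. \<epsilon> i \<omega>) = (\<Prod>i\<in>{m, n}. expectation (\<epsilon> i))"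
      using int[of _ 1] mn by (intro indep_vars_lebesgue_integral) auto
    then show ?thesis using False E1 mn by simp
  qed
qed

text \<open>The relation \<open>k_innovation\<close> is triangular with unit diagonal, so it
  expresses \<xi>(n) through \<epsilon>(n) and earlier \<xi>(i). Induction on n passes both
  integrability and orthogonality to later innovations from the orthonormal \<epsilon> to \<xi>. The
  two claims are proved together because the expectations can be split only for square integrable
  terms.\<close>

lemma (in prob_space) innovations_orthogonal:
  fixes \<xi> \<epsilon> :: "nat \<Rightarrow> 'a \<Rightarrow> real"
  assumes meas: "\<And>n. n \<ge> 1 \<Longrightarrow> \<xi> n \<in> borel_measurable M"
    and indep: "indep_vars (\<lambda>_. borel) \<epsilon> {1..}"
    and normal: "\<And>n. n \<ge> 1 \<Longrightarrow> distributed M lborel (\<epsilon> n) std_normal_density"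
    and k_diag: "\<And>n. n \<ge> 1 \<Longrightarrow> k n n = 1"
    and k_innovation: "\<And>n. n \<ge> 1 \<Longrightarrow> AE \<omega> in M. \<sigma> n * \<epsilon> n \<omega> = (\<Sum>i=1..n. k n i * \<xi> i \<omega>)"
  shows "n \<ge> 1 \<Longrightarrow> square_integrable M (\<xi> n)"
    and "n \<ge> 1 \<Longrightarrow> m \<ge> n \<Longrightarrow> expectation (\<lambda>\<omega>. \<epsilon> m \<omega> * \<xi> n \<omega>) = (if m = n then \<sigma> n else 0)"
proof -
  have eps: "\<And>n. n \<ge> 1 \<Longrightarrow> square_integrable M (\<epsilon> n)"
    "\<And>m n. m \<ge> 1 \<Longrightarrow> n \<ge> 1 \<Longrightarrow> expectation (\<lambda>\<omega>. \<epsilon> m \<omega> * \<epsilon> n \<omega>) = (if m = n then 1 else 0)"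
    using std_normal_indep_moments[OF indep] normal by blast+
  have "square_integrable M (\<xi> n) \<and> (\<forall>m\<ge>n. expectation (\<lambda>\<omega>. \<epsilon> m \<omega> * \<xi> n \<omega>) = (if m = n then \<sigma> n else 0))"
    if "n \<ge> 1" for n
    using that
  proof (induction n rule: less_induct)
    case (less n)
    have IH: "square_integrable M (\<xi> i)" "\<And>m. m \<ge> n \<Longrightarrow> expectation (\<lambda>\<omega>. \<epsilon> m \<omega> * \<xi> i \<omega>) = 0"
      if "i \<in> {1..<n}" for i using less that by auto
    have eq: "AE \<omega> in M. \<xi> n \<omega> = \<sigma> n * \<epsilon> n \<omega> + (\<Sum>i=1..<n. - k n i * \<xi> i \<omega>)"
      using k_innovation[OF less.prems]
    proof eventually_elim
      case (elim \<omega>)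
      have "(\<Sum>i=1..n. k n i * \<xi> i \<omega>) = (\<Sum>i=1..<n. k n i * \<xi> i \<omega>) + \<xi> n \<omega>"
        using less.prems k_diag[OF less.prems]
        by (simp add: atLeastLessThanSuc_atLeastAtMost[symmetric])
      then show ?case using elim by (simp add: sum_negf)
    qed
    have sq: "square_integrable M (\<xi> n)"
      by (rule square_integrable_cong_AE[OF _ meas[OF less.prems] eq])
        (intro square_integrable_add square_integrable_cmult square_integrable_sum eps IH less.prems; simp)
    have "expectation (\<lambda>\<omega>. \<epsilon> m \<omega> * \<xi> n \<omega>) = (if m = n then \<sigma> n else 0)" if m: "m \<ge> n" for m
    proof -
      have m1: "m \<ge> 1" using m less.prems by simp
      have [measurable]: "\<epsilon> m \<in> borel_measurable M" "\<epsilon> n \<in> borel_measurable M" "\<xi> n \<in> borel_measurable M"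
        using eps(1)[OF m1] eps(1)[OF less.prems] sq by (auto simp: square_integrable_def)
      have [measurable]: "\<xi> i \<in> borel_measurable M" if "i \<in> {1..<n}" for i using meas that by auto
      have "expectation (\<lambda>\<omega>. \<epsilon> m \<omega> * \<xi> n \<omega>) =
         expectation (\<lambda>\<omega>. \<sigma> n * (\<epsilon> m \<omega> * \<epsilon> n \<omega>) + (\<Sum>i=1..<n. - k n i * (\<epsilon> m \<omega> * \<xi> i \<omega>)))"
      proof (rule integral_cong_AE)
        show "AE \<omega> in M. \<epsilon> m \<omega> * \<xi> n \<omega> = \<sigma> n * (\<epsilon> m \<omega> * \<epsilon> n \<omega>) + (\<Sum>i=1..<n. - k n i * (\<epsilon> m \<omega> * \<xi> i \<omega>))"
          using eq
        proof eventually_elim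
          case (elim \<omega>)
          show ?case unfolding elim by (simp add: distrib_left right_diff_distrib sum_distrib_left mult.left_commute sum_negf)
        qed
      qed measurable
      also have "\<dots> = \<sigma> n * expectation (\<lambda>\<omega>. \<epsilon> m \<omega> * \<epsilon> n \<omega>) + (\<Sum>i=1..<n. - k n i * expectation (\<lambda>\<omega>. \<epsilon> m \<omega> * \<xi> i \<omega>))"
      proof (subst Bochner_Integration.integral_add)
        have int: "integrable M (\<lambda>\<omega>. - k n i * (\<epsilon> m \<omega> * \<xi> i \<omega>))" if "i \<in> {1..<n}" for i
          using square_integrable_mult[OF eps(1)[OF m1] IH(1)[OF that]] by simp
        then show "integrable M (\<lambda>\<omega>. \<Sum>i=1..<n. - k n i * (\<epsilon> m \<omega> * \<xi> i \<omega>))"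
          by (rule Bochner_Integration.integrable_sum)
        show "integrable M (\<lambda>\<omega>. \<sigma> n * (\<epsilon> m \<omega> * \<epsilon> n \<omega>))"
          using square_integrable_mult[OF eps(1)[OF m1] eps(1)[OF less.prems]] by simp
        show "expectation (\<lambda>\<omega>. \<sigma> n * (\<epsilon> m \<omega> * \<epsilon> n \<omega>)) + expectation (\<lambda>\<omega>. \<Sum>i=1..<n. - k n i * (\<epsilon> m \<omega> * \<xi> i \<omega>)) =
          \<sigma> n * expectation (\<lambda>\<omega>. \<epsilon> m \<omega> * \<epsilon> n \<omega>) + (\<Sum>i=1..<n. - k n i * expectation (\<lambda>\<omega>. \<epsilon> m \<omega> * \<xi> i \<omega>))"
          by (subst Bochner_Integration.integral_sum[OF int]) (simp_all only: integral_mult_right_zero)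
      qed
      also have "\<dots> = (if m = n then \<sigma> n else 0)" using eps(2)[OF m1 less.prems] IH(2)[OF _ m] by simp
      finally show ?thesis .
    qed
    with sq show ?case by blast
  qed
  then show "n \<ge> 1 \<Longrightarrow> square_integrable M (\<xi> n)"
    and "n \<ge> 1 \<Longrightarrow> m \<ge> n \<Longrightarrow> expectation (\<lambda>\<omega>. \<epsilon> m \<omega> * \<xi> n \<omega>) = (if m = n then \<sigma> n else 0)" by blast+
qed

lemma (in prob_space) strictly_stationary_cov:
  assumes st: "strictly_stationary M borel (\<lambda>n. \<xi> (Suc n))" and ij: "i \<ge> 1" "j \<ge> 1"
  shows "expectation (\<lambda>\<omega>. \<xi> (Suc i) \<omega> * \<xi> (Suc j) \<omega>) = expectation (\<lambda>\<omega>. \<xi> i \<omega> * (\<xi> j \<omega> :: real))"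
proof -
  have [measurable]: "\<xi> (Suc n) \<in> borel_measurable M" for n using st by (simp add: strictly_stationary_def)
  \<comment> \<open>Path index n stands for time n + 1, hence the coordinates i - 1 and j -
    1.\<close>
  let ?P = "Pi\<^sub>M UNIV (\<lambda>_::nat. borel :: real measure)" and ?f = "\<lambda>x :: nat \<Rightarrow> real. x (i - 1) * x (j - 1)"
  have E: "(\<integral>x. ?f x \<partial>distr M ?P (\<lambda>\<omega> n. \<xi> (Suc (n + m)) \<omega>)) = expectation (\<lambda>\<omega>. \<xi> (i + m) \<omega> * \<xi> (j + m) \<omega>)" for m
    using ij by (subst integral_distr) (auto intro!: measurable_PiM_single')
  have "distr M ?P (\<lambda>\<omega> n. \<xi> (Suc (n + 1)) \<omega>) = distr M ?P (\<lambda>\<omega> n. \<xi> (Suc (n + 0)) \<omega>)"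
    using st unfolding strictly_stationary_def by (metis add_0_right)
  then show ?thesis using E[of 1] E[of 0] by simp
qed

text \<open>Multiplying \<open>k_innovation\<close> by \<xi>(j) and integrating gives the normal
  equations: 0 for j < n by orthogonality, and \<sigma>(n) times the covariance \<sigma>(n) of
  \<epsilon>(n) and \<xi>(n) for j = n.\<close>

lemma (in prob_space) levinson_noise:
  fixes \<xi> \<epsilon> :: "nat \<Rightarrow> 'a \<Rightarrow> real"
  assumes st: "strictly_stationary M borel (\<lambda>n. \<xi> (Suc n))"
    and indep: "indep_vars (\<lambda>_. borel) \<epsilon> {1..}"
    and normal: "\<And>n. n \<ge> 1 \<Longrightarrow> distributed M lborel (\<epsilon> n) std_normal_density"
    and k_diag: "\<And>n. n \<ge> 1 \<Longrightarrow> k n n = 1"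
    and k_innovation: "\<And>n. n \<ge> 1 \<Longrightarrow> AE \<omega> in M. \<sigma> n * \<epsilon> n \<omega> = (\<Sum>i=1..n. k n i * \<xi> i \<omega>)"
    and \<sigma>: "\<And>n. n \<ge> 1 \<Longrightarrow> \<sigma> n > 0"
  shows "levinson (\<lambda>i j. expectation (\<lambda>\<omega>. \<xi> i \<omega> * \<xi> j \<omega>)) k (\<lambda>n. (\<sigma> n)\<^sup>2)"
proof -
  have meas: "\<xi> n \<in> borel_measurable M" if "n \<ge> 1" for n
    using st that unfolding strictly_stationary_def by (metis Suc_pred' less_eq_Suc_le One_nat_def)
  have orth: "\<And>n. n \<ge> 1 \<Longrightarrow> square_integrable M (\<xi> n)"
    "\<And>n m. n \<ge> 1 \<Longrightarrow> m \<ge> n \<Longrightarrow> expectation (\<lambda>\<omega>. \<epsilon> m \<omega> * \<xi> n \<omega>) = (if m = n then \<sigma> n else 0)"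
    using innovations_orthogonal[where \<xi> = \<xi> and \<epsilon> = \<epsilon> and k = k and \<sigma> = \<sigma>, OF _ indep] meas normal k_diag k_innovation by blast+
  have sum: "(\<Sum>i=1..n. k n i * expectation (\<lambda>\<omega>. \<xi> i \<omega> * \<xi> j \<omega>)) = (if n = j then (\<sigma> n)\<^sup>2 else 0)"
    if j: "1 \<le> j" "j \<le> n" for n j
  proof -
    have n: "n \<ge> 1" using j by simp
    have "(\<Sum>i=1..n. k n i * expectation (\<lambda>\<omega>. \<xi> i \<omega> * \<xi> j \<omega>)) = expectation (\<lambda>\<omega>. \<Sum>i=1..n. k n i * (\<xi> i \<omega> * \<xi> j \<omega>))"
      using orth(1) j by (subst Bochner_Integration.integral_sum) (auto intro!: square_integrable_mult)
    also have "\<dots> = expectation (\<lambda>\<omega>. \<sigma> n * (\<epsilon> n \<omega> * \<xi> j \<omega>))"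
    proof (rule integral_cong_AE)
      show "AE \<omega> in M. (\<Sum>i=1..n. k n i * (\<xi> i \<omega> * \<xi> j \<omega>)) = \<sigma> n * (\<epsilon> n \<omega> * \<xi> j \<omega>)"
        using k_innovation[OF n]
      proof eventually_elim
        case (elim \<omega>)
        have "\<sigma> n * (\<epsilon> n \<omega> * \<xi> j \<omega>) = (\<Sum>i=1..n. k n i * \<xi> i \<omega>) * \<xi> j \<omega>" unfolding elim[symmetric] by simp
        then show ?case by (simp only: sum_distrib_right mult.assoc)
      qed
    qed (use meas j n distributed_measurable[OF normal[OF n]] in \<open>auto intro!: borel_measurable_sum borel_measurable_times\<close>)
    also have "\<dots> = (if n = j then (\<sigma> n)\<^sup>2 else 0)" using orth(2)[of j n] j by (simp add: power2_eq_square)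
    finally show ?thesis .
  qed
  show ?thesis
  proof
    show "expectation (\<lambda>\<omega>. \<xi> (Suc i) \<omega> * \<xi> (Suc j) \<omega>) = expectation (\<lambda>\<omega>. \<xi> i \<omega> * \<xi> j \<omega>)" if "i \<ge> 1" "j \<ge> 1" for i j
      using strictly_stationary_cov[OF st that] .
    show "0 < (\<sigma> n)\<^sup>2" if "n \<ge> 1" for n using \<sigma>[OF that] by simp
  qed (use sum k_diag in \<open>auto simp: mult.commute\<close>)
qed

section \<open>Stationary autoregressions\<close>

lemma space_vec_borel [simp]: "space (vec_borel p) = carrier_vec p"
  by (simp add: vec_borel_def)

lemma measurable_vec_index:
  assumes "j < p" shows "(\<lambda>v. v $ j) \<in> borel_measurable (vec_borel p)"
proof -
  have "(\<lambda>v. \<lambda>i\<in>{..<p}. v $ i) \<in> measurable (vec_borel p) (Pi\<^sub>M {..<p} (\<lambda>_. borel))"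
    unfolding vec_borel_def by (rule measurable_vimage_algebra1) (auto simp: space_PiM)
  from measurable_compose[OF this measurable_component_singleton[of j]] assms show ?thesis by simp
qed

lemma measurable_vec_borelI:
  assumes "\<And>x. x \<in> space N \<Longrightarrow> g x \<in> carrier_vec p"
    and "\<And>j. j < p \<Longrightarrow> (\<lambda>x. g x $ j) \<in> borel_measurable N"
  shows "g \<in> measurable N (vec_borel p)"
  unfolding vec_borel_def
proof (rule measurable_vimage_algebra2)
  show "(\<lambda>x. \<lambda>i\<in>{..<p}. g x $ i) \<in> measurable N (Pi\<^sub>M {..<p} (\<lambda>_. borel))"
    using assms(2) by (intro measurable_restrict) auto
qed (use assms(1) in auto)

lemma measurable_mat_vec_index:
  fixes A :: "real mat"
  assumes A: "A \<in> carrier_mat p p" and g: "g \<in> measurable N (vec_borel p)" and j: "j < p"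
  shows "(\<lambda>x. (A *\<^sub>v g x) $ j) \<in> borel_measurable N"
proof -
  have c: "g x \<in> carrier_vec p" if "x \<in> space N" for x using measurable_space[OF g that] by simp
  have "(\<lambda>x. (A *\<^sub>v g x) $ j) \<in> borel_measurable N \<longleftrightarrow> (\<lambda>x. \<Sum>l<p. A $$ (j, l) * g x $ l) \<in> borel_measurable N"
  proof (rule measurable_cong)
    fix x assume "x \<in> space N"
    from c[OF this] show "(A *\<^sub>v g x) $ j = (\<Sum>l<p. A $$ (j, l) * g x $ l)"
      using A j by (simp add: scalar_prod_def lessThan_atLeast0)
  qed
  moreover have "(\<lambda>x. \<Sum>l<p. A $$ (j, l) * g x $ l) \<in> borel_measurable N"
    using measurable_compose[OF g measurable_vec_index] by (intro borel_measurable_sum borel_measurable_times borel_measurable_const) auto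
  ultimately show ?thesis by blast
qed

lemma ar_step_carrier [simp]: "A \<in> carrier_mat p p \<Longrightarrow> ar_step p A s v e \<in> carrier_vec p"
  by (rule carrier_vecI) (simp add: ar_step_def)

lemma measurable_ar_step:
  assumes A: "A \<in> carrier_mat p p" and g: "g \<in> measurable N (vec_borel p)" and h: "h \<in> borel_measurable N"
  shows "(\<lambda>x. ar_step p A s (g x) (h x)) \<in> measurable N (vec_borel p)"
proof (rule measurable_vec_borelI)
  fix j assume j: "j < p"
  have "ar_step p A s (g x) (h x) $ j = (A *\<^sub>v g x) $ j + s * h x * unit_vec p 0 $ j" for x
    using j A by (simp add: ar_step_def)
  then show "(\<lambda>x. ar_step p A s (g x) (h x) $ j) \<in> borel_measurable N"
    using measurable_mat_vec_index[OF A g j] h by simp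
qed (use A in simp)

section \<open>Paths as functions of the start and the noise\<close>

abbreviation (input) "std_normal \<equiv> density lborel (\<lambda>x. ennreal (std_normal_density x))"
abbreviation (input) "noise_law \<equiv> Pi\<^sub>M UNIV (\<lambda>_::nat. std_normal)"
text \<open>Like \<open>path_space\<close>, this serves only as a sigma-algebra; the probability on
  it is \<open>noise_law\<close>.\<close>

abbreviation (input) "noise_space \<equiv> Pi\<^sub>M UNIV (\<lambda>_::nat. borel :: real measure)"
abbreviation (input) "path_space p \<equiv> Pi\<^sub>M UNIV (\<lambda>_::nat. vec_borel p)"

lemma prob_space_std_normal: "prob_space std_normal"
  by (rule prob_space_normal_density) simp

lemma sets_noise_law [measurable_cong]: "sets noise_law = sets noise_space"
  by (intro sets_PiM_cong) auto

lemma prob_space_noise_law: "prob_space noise_law"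
  by (intro prob_space_PiM prob_space_std_normal)

text \<open>The entry \<open>e n\<close> drives the step from n to n + 1, so it plays the part of
  \<epsilon>(n + 1).\<close>

fun ar_path :: "nat \<Rightarrow> real mat \<Rightarrow> real \<Rightarrow> real vec \<times> (nat \<Rightarrow> real) \<Rightarrow> nat \<Rightarrow> real vec" where
  "ar_path p A s (v, e) 0 = v"
| "ar_path p A s (v, e) (Suc n) = ar_step p A s (ar_path p A s (v, e) n) (e n)"

text \<open>A skew product: the first noise value is spent on the state and the rest moves up. On
  paths it acts as the time shift.\<close>

definition ar_shift :: "nat \<Rightarrow> real mat \<Rightarrow> real \<Rightarrow> real vec \<times> (nat \<Rightarrow> real) \<Rightarrow> real vec \<times> (nat \<Rightarrow> real)" where
  "ar_shift p A s x = (ar_step p A s (fst x) (snd x 0), \<lambda>n. snd x (Suc n))"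

lemma ar_path_shift: "ar_path p A s (ar_shift p A s x) n = ar_path p A s x (Suc n)"
  by (induction n; cases x) (simp_all add: ar_shift_def)

lemma measurable_ar_path:
  assumes A: "A \<in> carrier_mat p p"
  shows "ar_path p A s \<in> measurable (vec_borel p \<Otimes>\<^sub>M noise_space) (path_space p)"
proof -
  have n: "(\<lambda>x. ar_path p A s x n) \<in> measurable (vec_borel p \<Otimes>\<^sub>M noise_space) (vec_borel p)" for n
  proof (induction n)
    case 0
    have "(\<lambda>x. ar_path p A s x 0) = fst" by (auto simp: fun_eq_iff)
    then show ?case by simp
  next
    case (Suc n)
    have "(\<lambda>x. ar_path p A s x (Suc n)) = (\<lambda>x. ar_step p A s (ar_path p A s x n) (snd x n))" by (auto simp: fun_eq_iff)
    then show ?case using measurable_ar_step[OF A Suc, of "\<lambda>x. snd x n" s] by simp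
  qed
  then show ?thesis by (intro measurable_PiM_single') (auto simp: space_PiM measurable_space[OF n, simplified])
qed

lemma measurable_ar_shift:
  assumes A: "A \<in> carrier_mat p p"
  shows "ar_shift p A s \<in> measurable (vec_borel p \<Otimes>\<^sub>M noise_space) (vec_borel p \<Otimes>\<^sub>M noise_space)"
  unfolding ar_shift_def[abs_def]
  by (intro measurable_Pair measurable_ar_step[OF A] measurable_PiM_single') auto

lemma nn_integral_noise_law_Suc:
  assumes [measurable]: "f \<in> borel_measurable noise_space"
  shows "(\<integral>\<^sup>+e. f e \<partial>noise_law) = (\<integral>\<^sup>+a. \<integral>\<^sup>+e. f (case_nat a e) \<partial>noise_law \<partial>std_normal)"
proof -
  interpret E: prob_space std_normal by (rule prob_space_std_normal)
  interpret N: prob_space noise_law by (rule prob_space_noise_law)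
  interpret sequence_space std_normal ..
  have "(\<integral>\<^sup>+e. f e \<partial>noise_law) = (\<integral>\<^sup>+e. f e \<partial>distr (std_normal \<Otimes>\<^sub>M noise_law) noise_law (\<lambda>(a, e). case_nat a e))"
    by (simp add: PiM_iter)
  also have "\<dots> = (\<integral>\<^sup>+x. f (case_nat (fst x) (snd x)) \<partial>(std_normal \<Otimes>\<^sub>M noise_law))"
    by (subst nn_integral_distr) (auto simp: split_beta')
  also have "\<dots> = (\<integral>\<^sup>+a. \<integral>\<^sup>+e. f (case_nat a e) \<partial>noise_law \<partial>std_normal)"
    by (subst N.nn_integral_fst[symmetric]) auto
  finally show ?thesis .
qed

text \<open>The noise value that is spent is independent of the remaining noise, so the new state
  has law \<mu> again, independently of a sequence that is again distributed as
  \<open>noise_law\<close>.\<close>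

lemma distr_ar_shift:
  assumes A: "A \<in> carrier_mat p p" and law: "ar_stationary_law p A s \<mu>"
  shows "distr (\<mu> \<Otimes>\<^sub>M noise_law) (vec_borel p \<Otimes>\<^sub>M noise_space) (ar_shift p A s) = \<mu> \<Otimes>\<^sub>M noise_law"
proof (rule measure_eqI)
  from law have \<mu>: "prob_space \<mu>" and [measurable_cong]: "sets \<mu> = sets (vec_borel p)"
    and inv: "distr (\<mu> \<Otimes>\<^sub>M std_normal) (vec_borel p) (\<lambda>(v, e). ar_step p A s v e) = \<mu>"
    by (auto simp: ar_stationary_law_def)
  interpret \<mu>: prob_space \<mu> by fact
  interpret E: prob_space std_normal by (rule prob_space_std_normal)
  interpret N: prob_space noise_law by (rule prob_space_noise_law)
  note [measurable] = measurable_ar_shift[OF A] measurable_ar_step[OF A]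
  show "sets (distr (\<mu> \<Otimes>\<^sub>M noise_law) (vec_borel p \<Otimes>\<^sub>M noise_space) (ar_shift p A s)) = sets (\<mu> \<Otimes>\<^sub>M noise_law)"
    by (simp cong: sets_pair_measure_cong add: sets_noise_law \<open>sets \<mu> = sets (vec_borel p)\<close>)
  fix B assume "B \<in> sets (distr (\<mu> \<Otimes>\<^sub>M noise_law) (vec_borel p \<Otimes>\<^sub>M noise_space) (ar_shift p A s))"
  then have B[measurable]: "B \<in> sets (vec_borel p \<Otimes>\<^sub>M noise_space)" by simp
  \<comment> \<open>Integrating out the remaining noise first leaves a function of the new state
    alone, to which the invariance of \<mu> under a single step applies.\<close>
  define g where "g v = (\<integral>\<^sup>+e. indicator B (v, e) \<partial>noise_law)" for v
  have [measurable]: "g \<in> borel_measurable (vec_borel p)" unfolding g_def by measurable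
  have "emeasure (distr (\<mu> \<Otimes>\<^sub>M noise_law) (vec_borel p \<Otimes>\<^sub>M noise_space) (ar_shift p A s)) B =
    (\<integral>\<^sup>+x. indicator B (ar_shift p A s x) \<partial>(\<mu> \<Otimes>\<^sub>M noise_law))"
    by (subst nn_integral_indicator[symmetric], simp, subst nn_integral_distr) auto
  also have "\<dots> = (\<integral>\<^sup>+v. \<integral>\<^sup>+e. indicator B (ar_shift p A s (v, e)) \<partial>noise_law \<partial>\<mu>)"
    by (subst N.nn_integral_fst[symmetric]) auto
  also have "\<dots> = (\<integral>\<^sup>+v. \<integral>\<^sup>+a. g (ar_step p A s v a) \<partial>std_normal \<partial>\<mu>)"
  proof (rule nn_integral_cong)
    fix v assume v: "v \<in> space \<mu>"
    then have [measurable]: "v \<in> space (vec_borel p)" using sets_eq_imp_space_eq[OF \<open>sets \<mu> = _\<close>] by simp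
    show "(\<integral>\<^sup>+e. indicator B (ar_shift p A s (v, e)) \<partial>noise_law) = (\<integral>\<^sup>+a. g (ar_step p A s v a) \<partial>std_normal)"
    proof (subst nn_integral_noise_law_Suc)
      have "(\<lambda>e. ar_shift p A s (v, e)) \<in> measurable noise_space (vec_borel p \<Otimes>\<^sub>M noise_space)"
        by measurable
      then show "(\<lambda>e. indicator B (ar_shift p A s (v, e)) :: ennreal) \<in> borel_measurable noise_space"
        by measurable
    qed (simp add: ar_shift_def g_def)
  qed
  also have "\<dots> = (\<integral>\<^sup>+x. g (ar_step p A s (fst x) (snd x)) \<partial>(\<mu> \<Otimes>\<^sub>M std_normal))"
    by (subst E.nn_integral_fst[symmetric]) auto
  also have "\<dots> = (\<integral>\<^sup>+v. g v \<partial>distr (\<mu> \<Otimes>\<^sub>M std_normal) (vec_borel p) (\<lambda>(v, e). ar_step p A s v e))"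
    by (subst nn_integral_distr) (auto simp: split_beta')
  also have "\<dots> = (\<integral>\<^sup>+v. g v \<partial>\<mu>)" unfolding inv ..
  also have "\<dots> = emeasure (\<mu> \<Otimes>\<^sub>M noise_law) B"
    unfolding g_def by (subst N.nn_integral_fst) (auto simp: nn_integral_indicator)
  finally show "emeasure (distr (\<mu> \<Otimes>\<^sub>M noise_law) (vec_borel p \<Otimes>\<^sub>M noise_space) (ar_shift p A s)) B = emeasure (\<mu> \<Otimes>\<^sub>M noise_law) B" .
qed

section \<open>Coupling of two sequences with equal laws\<close>

lemma tendsto_0_approx:
  fixes f v :: "nat \<Rightarrow> real" and u :: "nat \<Rightarrow> nat \<Rightarrow> real"
  assumes bound: "\<And>k m. f m \<le> u k m + v k" and f: "\<And>m. f m \<ge> 0"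
    and u: "\<And>k. u k \<longlonglongrightarrow> 0" and v: "v \<longlonglongrightarrow> 0"
  shows "f \<longlonglongrightarrow> 0"
proof (rule LIMSEQ_I)
  fix e :: real assume "e > 0"
  then have e: "e / 2 > 0" by simp
  from LIMSEQ_D[OF v e] obtain k where k: "\<bar>v k\<bar> < e / 2" by auto
  from LIMSEQ_D[OF u e, of k] obtain m0 where "\<And>m. m \<ge> m0 \<Longrightarrow> \<bar>u k m\<bar> < e / 2" by auto
  then have "\<bar>f m\<bar> < e" if "m \<ge> m0" for m using bound[of m k] f[of m] k that by (smt (verit) field_sum_of_halves)
  then show "\<exists>m0. \<forall>m\<ge>m0. norm (f m - 0) < e" by auto
qed

text \<open>The law Q is the same for both sequences and for all m. An event of small Q-measure is
  therefore negligible for both, uniformly in m, which is what approximating a set requires.\<close>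

locale equal_law_sequences = R: prob_space R for R :: "'r measure" +
  fixes N Q :: "'s measure" and x y :: "nat \<Rightarrow> 'r \<Rightarrow> 's"
  assumes x_meas [measurable]: "\<And>m. x m \<in> measurable R N" and y_meas [measurable]: "\<And>m. y m \<in> measurable R N"
    and x_law: "\<And>m. distr R N (x m) = Q" and y_law: "\<And>m. distr R N (y m) = Q"
begin

definition mismatch :: "'s set \<Rightarrow> nat \<Rightarrow> real" where
  "mismatch B m = measure R {r \<in> space R. (x m r \<in> B) \<noteq> (y m r \<in> B)}"

definition coupled_sets :: "'s set set" where
  "coupled_sets = {B \<in> sets N. mismatch B \<longlonglongrightarrow> 0}"

lemma sets_Q: "sets Q = sets N" using x_law[of 0] by auto

lemma prob_space_Q: "prob_space Q"
  using R.prob_space_distr[OF x_meas, of 0] by (simp add: x_law)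

lemma measure_law:
  assumes B: "B \<in> sets N"
  shows "measure R {r \<in> space R. x m r \<in> B} = measure Q B" "measure R {r \<in> space R. y m r \<in> B} = measure Q B"
proof -
  have "measure (distr R N (x m)) B = measure R {r \<in> space R. x m r \<in> B}"
    using B by (subst measure_distr) (auto intro: arg_cong[where f = "measure R"])
  then show "measure R {r \<in> space R. x m r \<in> B} = measure Q B" by (simp add: x_law)
  have "measure (distr R N (y m)) B = measure R {r \<in> space R. y m r \<in> B}"
    using B by (subst measure_distr) (auto intro: arg_cong[where f = "measure R"])
  then show "measure R {r \<in> space R. y m r \<in> B} = measure Q B" by (simp add: y_law)
qed

lemma mismatch_nonneg: "mismatch B m \<ge> 0"
  by (simp add: mismatch_def)

lemma mismatch_Un:
  assumes [measurable]: "A \<in> sets N" "B \<in> sets N"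
  shows "mismatch (A \<union> B) m \<le> mismatch A m + mismatch B m"
proof -
  have "mismatch (A \<union> B) m \<le> measure R ({r \<in> space R. (x m r \<in> A) \<noteq> (y m r \<in> A)} \<union> {r \<in> space R. (x m r \<in> B) \<noteq> (y m r \<in> B)})"
    unfolding mismatch_def by (rule R.finite_measure_mono) auto
  also have "\<dots> \<le> mismatch A m + mismatch B m"
    unfolding mismatch_def by (rule measure_Un_le) auto
  finally show ?thesis .
qed

lemma coupled_Un:
  assumes "A \<in> coupled_sets" "B \<in> coupled_sets"
  shows "A \<union> B \<in> coupled_sets"
proof -
  from assms have sets: "A \<in> sets N" "B \<in> sets N" and lim: "mismatch A \<longlonglongrightarrow> 0" "mismatch B \<longlonglongrightarrow> 0"
    by (auto simp: coupled_sets_def)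
  have "mismatch (A \<union> B) \<longlonglongrightarrow> 0"
  proof (rule Lim_null_comparison[OF always_eventually tendsto_add_zero[OF lim]], rule allI)
    show "norm (mismatch (A \<union> B) m) \<le> mismatch A m + mismatch B m" for m
      using mismatch_Un[OF sets, of m] mismatch_nonneg[of "A \<union> B" m] by simp
  qed
  with sets show ?thesis by (simp add: coupled_sets_def)
qed

text \<open>For a countable union U, the finite unions V(k) are coupled, and replacing U by V(k)
  costs at most twice the Q-measure of U - V(k), whatever m is. So m may tend to infinity for fixed
  k, and k afterwards.\<close>

lemma sigma_algebra_coupled_sets: "sigma_algebra (space N) coupled_sets"
  unfolding sigma_algebra_iff2
proof (intro conjI ballI allI impI)
  interpret Q: prob_space Q by (rule prob_space_Q)
  show "coupled_sets \<subseteq> Pow (space N)" using sets.sets_into_space by (auto simp: coupled_sets_def)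
  show empty: "{} \<in> coupled_sets" by (simp add: coupled_sets_def mismatch_def[abs_def])
  show "space N - B \<in> coupled_sets" if B: "B \<in> coupled_sets" for B
  proof -
    have "{r \<in> space R. (x m r \<in> space N - B) \<noteq> (y m r \<in> space N - B)} = {r \<in> space R. (x m r \<in> B) \<noteq> (y m r \<in> B)}" for m
      using measurable_space[OF x_meas] measurable_space[OF y_meas] by auto
    then have "mismatch (space N - B) = mismatch B" by (simp only: mismatch_def[abs_def])
    then show ?thesis using B by (auto simp: coupled_sets_def)
  qed
  fix A :: "nat \<Rightarrow> 's set" assume "range A \<subseteq> coupled_sets"
  then have A: "A i \<in> coupled_sets" for i by auto
  then have A_sets[measurable]: "A i \<in> sets N" for i by (auto simp: coupled_sets_def)
  define U where "U = (\<Union>i. A i)"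
  define V where "V n = (\<Union>i<n. A i)" for n
  have [measurable]: "U \<in> sets N" "V n \<in> sets N" for n by (auto simp: U_def V_def)
  have V: "V n \<in> coupled_sets" for n
    by (induction n) (auto simp: V_def lessThan_Suc empty intro!: coupled_Un A)
  have "mismatch U \<longlonglongrightarrow> 0"
  proof (rule tendsto_0_approx)
    show "mismatch (V k) \<longlonglongrightarrow> 0" for k using V by (simp add: coupled_sets_def)
    show "mismatch U m \<le> mismatch (V k) m + 2 * measure Q (U - V k)" for k m
    proof -
      have "mismatch U m \<le> measure R ({r \<in> space R. (x m r \<in> V k) \<noteq> (y m r \<in> V k)} \<union>
         ({r \<in> space R. x m r \<in> U - V k} \<union> {r \<in> space R. y m r \<in> U - V k}))"
        unfolding mismatch_def by (rule R.finite_measure_mono) (auto simp: U_def V_def)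
      also have "\<dots> \<le> mismatch (V k) m + measure R ({r \<in> space R. x m r \<in> U - V k} \<union> {r \<in> space R. y m r \<in> U - V k})"
        unfolding mismatch_def by (rule measure_Un_le) auto
      also have "measure R ({r \<in> space R. x m r \<in> U - V k} \<union> {r \<in> space R. y m r \<in> U - V k}) \<le>
         measure R {r \<in> space R. x m r \<in> U - V k} + measure R {r \<in> space R. y m r \<in> U - V k}"
        by (rule measure_Un_le) auto
      also have "\<dots> = 2 * measure Q (U - V k)" using measure_law[of "U - V k" m] by simp
      finally show ?thesis by simp
    qed
    have "(\<lambda>k. measure Q (U - V k)) \<longlonglongrightarrow> measure Q (\<Inter>k. U - V k)"
    proof (rule Q.finite_Lim_measure_decseq)
      show "range (\<lambda>k. U - V k) \<subseteq> sets Q" by (auto simp: sets_Q)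
      show "decseq (\<lambda>k. U - V k)" by (auto simp: decseq_def V_def)
    qed
    also have "(\<Inter>k. U - V k) = {}" by (auto simp: U_def V_def)
    finally show "(\<lambda>k. 2 * measure Q (U - V k)) \<longlonglongrightarrow> 0" using tendsto_mult_right_zero by fastforce
  qed (rule mismatch_nonneg)
  then show "(\<Union>i. A i) \<in> coupled_sets" by (auto simp: coupled_sets_def U_def)
qed

text \<open>The half-open slices \<open>{a<..a+\<delta>}\<close> shrink to the empty set, so the common law may have
  atoms.\<close>

lemma coupled_halfspace:
  assumes c[measurable]: "c \<in> borel_measurable N"
    and conv: "AE r in R. (\<lambda>m. c (x m r) - c (y m r)) \<longlonglongrightarrow> (0::real)"
  shows "{s \<in> space N. c s \<le> a} \<in> coupled_sets"
proof -
  interpret Q: prob_space Q by (rule prob_space_Q)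
  define d :: "nat \<Rightarrow> real" where "d k = 1 / real (Suc k)" for k
  have d: "d k > 0" for k by (simp add: d_def)
  define S where "S k = {s \<in> space N. a < c s \<and> c s \<le> a + d k}" for k
  have [measurable]: "S k \<in> sets N" for k by (simp add: S_def)
  have "mismatch {s \<in> space N. c s \<le> a} \<longlonglongrightarrow> 0"
  proof (rule tendsto_0_approx)
    show "mismatch {s \<in> space N. c s \<le> a} m \<le>
      measure R {r \<in> space R. \<bar>c (x m r) - c (y m r)\<bar> > d k} + 2 * measure Q (S k)" for k m
    proof -
      have "mismatch {s \<in> space N. c s \<le> a} m \<le> measure R ({r \<in> space R. \<bar>c (x m r) - c (y m r)\<bar> > d k} \<union>
         ({r \<in> space R. x m r \<in> S k} \<union> {r \<in> space R. y m r \<in> S k}))"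
        unfolding mismatch_def using measurable_space[OF x_meas] measurable_space[OF y_meas]
        by (intro R.finite_measure_mono) (auto simp: S_def)
      also have "\<dots> \<le> measure R {r \<in> space R. \<bar>c (x m r) - c (y m r)\<bar> > d k} + measure R ({r \<in> space R. x m r \<in> S k} \<union> {r \<in> space R. y m r \<in> S k})"
        by (rule measure_Un_le) auto
      also have "measure R ({r \<in> space R. x m r \<in> S k} \<union> {r \<in> space R. y m r \<in> S k}) \<le>
         measure R {r \<in> space R. x m r \<in> S k} + measure R {r \<in> space R. y m r \<in> S k}"
        by (rule measure_Un_le) auto
      also have "\<dots> = 2 * measure Q (S k)" using measure_law[of "S k" m] by simp
      finally show ?thesis by simp
    qed
    show "(\<lambda>m. measure R {r \<in> space R. \<bar>c (x m r) - c (y m r)\<bar> > d k}) \<longlonglongrightarrow> 0" for k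
    proof -
      let ?A = "\<lambda>m. {r \<in> space R. \<bar>c (x m r) - c (y m r)\<bar> > d k}"
      have "(\<lambda>m. \<integral>r. indicator (?A m) r \<partial>R) \<longlonglongrightarrow> (\<integral>r. (0::real) \<partial>R)"
      proof (rule integral_dominated_convergence[where w = "\<lambda>_. 1"])
        show "AE r in R. (\<lambda>m. indicator (?A m) r :: real) \<longlonglongrightarrow> 0"
          using conv
        proof eventually_elim
          case (elim r)
          have "\<forall>\<^sub>F m in sequentially. \<bar>c (x m r) - c (y m r)\<bar> < d k"
            using order_tendstoD(2)[OF tendsto_rabs_zero[OF elim] d] .
          then have "\<forall>\<^sub>F m in sequentially. indicator (?A m) r = (0::real)"
            by eventually_elim (auto simp: indicator_def)
          then show ?case by (rule tendsto_eventually)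
        qed
      qed (auto simp: indicator_def)
      then show ?thesis by simp
    qed
    have "(\<lambda>k. measure Q (S k)) \<longlonglongrightarrow> measure Q (\<Inter>k. S k)"
    proof (rule Q.finite_Lim_measure_decseq)
      show "range S \<subseteq> sets Q" by (auto simp: sets_Q)
      have "d n \<le> d m" if "m \<le> n" for m n using that by (simp add: d_def frac_le)
      then show "decseq S" unfolding decseq_def S_def by fastforce
    qed
    also have "(\<Inter>k. S k) = {}"
    proof -
      have "s \<notin> (\<Inter>k. S k)" for s
      proof
        assume s: "s \<in> (\<Inter>k. S k)"
        have "c s \<le> a"
        proof (rule tendsto_lowerbound)
          have "d \<longlonglongrightarrow> 0" unfolding d_def using LIMSEQ_inverse_real_of_nat by (simp add: inverse_eq_divide)
          then show "(\<lambda>k. a + d k) \<longlonglongrightarrow> a" by (auto intro!: tendsto_eq_intros)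
          show "\<forall>\<^sub>F k in sequentially. c s \<le> a + d k" using s by (auto simp: S_def)
        qed simp
        then show False using s by (auto simp: S_def)
      qed
      then show ?thesis by blast
    qed
    finally show "(\<lambda>k. 2 * measure Q (S k)) \<longlonglongrightarrow> 0" using tendsto_mult_right_zero by fastforce
  qed (rule mismatch_nonneg)
  then show ?thesis by (auto simp: coupled_sets_def)
qed

end

lemma coupled_paths:
  assumes "equal_law_sequences R (path_space p) Q x y"
    and conv: "\<And>n j. j < p \<Longrightarrow> AE r in R. (\<lambda>m. x m r n $ j - y m r n $ j) \<longlonglongrightarrow> 0"
    and B: "B \<in> sets (path_space p)"
  shows "(\<lambda>m. measure R {r \<in> space R. (x m r \<in> B) \<noteq> (y m r \<in> B)}) \<longlonglongrightarrow> 0"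
proof -
  interpret equal_law_sequences R "path_space p" Q x y by fact
  interpret D: sigma_algebra "space (path_space p)" coupled_sets by (rule sigma_algebra_coupled_sets)
  \<comment> \<open>The path space with the coupled sets as its sigma-algebra. That it contains all
    measurable sets is the measurability of the identity from L, which is checked on coordinates and
    there on half-lines.\<close>
  define L where "L = measure_of (space (path_space p)) coupled_sets (\<lambda>_. 0)"
  have L: "space L = space (path_space p)" "sets L = coupled_sets" by (simp_all add: L_def)
  have "(\<lambda>w n. w n) \<in> measurable L (path_space p)"
  proof (rule measurable_PiM_single')
    show "(\<lambda>w. w n) \<in> measurable L (vec_borel p)" for n
    proof (rule measurable_vec_borelI)
      show "w n \<in> carrier_vec p" if "w \<in> space L" for w using that by (auto simp: L space_PiM PiE_def)
      show "(\<lambda>w. w n $ j) \<in> borel_measurable L" if j: "j < p" for j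
        unfolding borel_measurable_iff_le L
      proof
        fix a
        have "(\<lambda>w. w n) \<in> measurable (path_space p) (vec_borel p)" by simp
        from measurable_compose[OF this measurable_vec_index[OF j]]
        have "(\<lambda>w. w n $ j) \<in> borel_measurable (path_space p)" .
        then show "{w \<in> space (path_space p). w n $ j \<le> a} \<in> coupled_sets"
          using conv[OF j] by (rule coupled_halfspace)
      qed
    qed
  qed (auto simp: L space_PiM)
  from measurable_sets[OF this B] have "B \<in> coupled_sets"
    using sets.sets_into_space[OF B] by (simp add: L Int_absorb2)
  then show ?thesis by (simp add: coupled_sets_def mismatch_def[abs_def])
qed

section \<open>Merging of paths driven by the same noise\<close>

lemma ar_path_carrier:
  assumes "A \<in> carrier_mat p p" "fst x \<in> carrier_vec p" shows "ar_path p A s x n \<in> carrier_vec p"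
  using assms by (cases x; cases n) auto

text \<open>The common noise cancels, so the difference solves the homogeneous recursion of a stable
  matrix.\<close>

lemma ar_path_diff_tendsto_0:
  assumes A: "A \<in> carrier_mat p p" and p: "p > 0"
    and stable: "spectral_radius (map_mat complex_of_real A) < 1"
    and v: "v \<in> carrier_vec p" and w: "w \<in> carrier_vec p" and j: "j < p"
  shows "(\<lambda>n. ar_path p A s (v, e) n $ j - ar_path p A s (w, e) n $ j) \<longlonglongrightarrow> 0"
proof -
  obtain t c where t: "0 < t" "t < 1" and c: "c \<ge> 0"
    and bound: "\<And>k v. v \<in> carrier_vec p \<Longrightarrow> l1_norm (A ^\<^sub>m k *\<^sub>v v) \<le> c * t ^ k * l1_norm v"
    by (rule stable_matrix_power_bound[OF A p stable, of thesis]) (rule that)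
  let ?D = "\<lambda>n. ar_path p A s (v, e) n - ar_path p A s (w, e) n"
  have carr: "ar_path p A s (v, e) n \<in> carrier_vec p" "ar_path p A s (w, e) n \<in> carrier_vec p" for n
    using ar_path_carrier[OF A] v w by auto
  have "l1_norm (?D n) \<le> c * (t ^ n * l1_norm (v - w))" for n
  proof (rule affine_rec_norm_bound[OF A c bound, where u = "\<lambda>_. 0\<^sub>v p"])
    show "?D n \<in> carrier_vec p" for n using carr by (intro minus_carrier_vec)
    show "0\<^sub>v p \<in> carrier_vec p" by simp
    show "l1_norm (?D 0) \<le> t ^ 0 * l1_norm (v - w)" by simp
    show "t ^ Suc n * l1_norm (v - w) = t * (t ^ n * l1_norm (v - w)) + l1_norm (0\<^sub>v p)" for n
      by (simp add: l1_norm_def)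
    show "t \<ge> 0" using t by simp
    show "?D (Suc n) = A *\<^sub>v ?D n + 0\<^sub>v p" for n
    proof -
      have "A *\<^sub>v ?D n = A *\<^sub>v ar_path p A s (v, e) n - A *\<^sub>v ar_path p A s (w, e) n"
        using A carr by (intro mult_minus_distrib_mat_vec)
      moreover have "A *\<^sub>v ar_path p A s (v, e) n \<in> carrier_vec p" "A *\<^sub>v ar_path p A s (w, e) n \<in> carrier_vec p"
        using A carr by (auto intro: mult_mat_vec_carrier)
      ultimately show ?thesis by (intro eq_vecI) (simp_all add: ar_step_def carrier_matD[OF A])
    qed
  qed
  moreover have "norm (?D n $ j) \<le> l1_norm (?D n)" for n
    using carr[of n] j abs_index_le_l1_norm[of j "?D n"] by simp
  ultimately have le: "norm (?D n $ j) \<le> c * (t ^ n * l1_norm (v - w))" for n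
    by (rule order_trans[rotated])
  have "(\<lambda>n. t ^ n) \<longlonglongrightarrow> 0" by (rule LIMSEQ_power_zero) (use t in simp)
  then have "(\<lambda>n. c * (t ^ n * l1_norm (v - w))) \<longlonglongrightarrow> 0"
    by (rule tendsto_mult_right_zero[OF tendsto_mult_left_zero])
  then have "(\<lambda>n. ?D n $ j) \<longlonglongrightarrow> 0"
    by (rule Lim_null_comparison[OF always_eventually, rotated]) (rule allI, rule le)
  then show ?thesis using carrier_vecD[OF carr(2)] j by simp
qed

lemma ar_path_tail_law:
  assumes A: "A \<in> carrier_mat p p" and law: "ar_stationary_law p A s \<mu>"
  shows "(\<lambda>x n. ar_path p A s x (n + m)) \<in> measurable (vec_borel p \<Otimes>\<^sub>M noise_space) (path_space p)" (is "?meas m")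
    and "distr (\<mu> \<Otimes>\<^sub>M noise_law) (path_space p) (\<lambda>x n. ar_path p A s x (n + m)) =
      distr (\<mu> \<Otimes>\<^sub>M noise_law) (path_space p) (ar_path p A s)" (is "?law m")
proof -
  have meas: "?meas m" for m
  proof (rule measurable_PiM_single')
    show comp: "(\<lambda>x. ar_path p A s x (n + m)) \<in> measurable (vec_borel p \<Otimes>\<^sub>M noise_space) (vec_borel p)" for n
      using measurable_compose[OF measurable_ar_path[OF A] measurable_component_singleton[of "n + m" UNIV "\<lambda>_. vec_borel p"]] by simp
    show "(\<lambda>x n. ar_path p A s x (n + m)) \<in> space (vec_borel p \<Otimes>\<^sub>M noise_space) \<rightarrow> (\<Pi>\<^sub>E i\<in>UNIV. space (vec_borel p))"
      using measurable_space[OF comp] by (simp only: PiE_UNIV_domain) blast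
  qed
  have [measurable_cong]: "sets \<mu> = sets (vec_borel p)" using law by (simp add: ar_stationary_law_def)
  have cong: "measurable (\<mu> \<Otimes>\<^sub>M noise_law) K = measurable (vec_borel p \<Otimes>\<^sub>M noise_space) K" for K :: "'x measure"
    by (intro measurable_cong_sets sets_pair_measure_cong sets_noise_law \<open>sets \<mu> = _\<close> refl)
  have "?law m" for m
  proof (induction m)
    case (Suc m)
    have "(\<lambda>x n. ar_path p A s x (n + Suc m)) = (\<lambda>x n. ar_path p A s x (n + m)) \<circ> ar_shift p A s"
      by (auto simp: fun_eq_iff ar_path_shift)
    then have "distr (\<mu> \<Otimes>\<^sub>M noise_law) (path_space p) (\<lambda>x n. ar_path p A s x (n + Suc m)) =
      distr (distr (\<mu> \<Otimes>\<^sub>M noise_law) (vec_borel p \<Otimes>\<^sub>M noise_space) (ar_shift p A s)) (path_space p) (\<lambda>x n. ar_path p A s x (n + m))"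
      by (simp only: distr_distr[OF meas measurable_ar_shift[OF A, folded cong]])
    then show ?case using Suc by (simp add: distr_ar_shift[OF A law])
  qed simp
  with meas show "?meas m" "?law m" by auto
qed

text \<open>The probability that B separates the two paths from time m on tends to 0 by coupling,
  but does not depend on m by invariance; hence it is 0.\<close>

lemma ar_path_invariant_forgets_start:
  assumes A: "A \<in> carrier_mat p p" and p: "p > 0"
    and stable: "spectral_radius (map_mat complex_of_real A) < 1"
    and law: "ar_stationary_law p A s \<mu>"
    and B: "B \<in> sets (path_space p)"
    and inv: "(\<lambda>w n. w (Suc n)) -` B \<inter> space (path_space p) = B"
  shows "AE r in \<mu> \<Otimes>\<^sub>M (\<mu> \<Otimes>\<^sub>M noise_law).
    (ar_path p A s (snd r) \<in> B) = (ar_path p A s (fst r, snd (snd r)) \<in> B)"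
proof -
  from law have \<mu>: "prob_space \<mu>" and sets_\<mu>[measurable_cong]: "sets \<mu> = sets (vec_borel p)"
    by (auto simp: ar_stationary_law_def)
  have space_\<mu>: "space \<mu> = carrier_vec p" using sets_eq_imp_space_eq[OF sets_\<mu>] by simp
  interpret \<mu>: prob_space \<mu> by fact
  interpret N: prob_space noise_law by (rule prob_space_noise_law)
  interpret \<pi>: prob_space "\<mu> \<Otimes>\<^sub>M noise_law" by (intro prob_space_pair) unfold_locales
  define R where "R = \<mu> \<Otimes>\<^sub>M (\<mu> \<Otimes>\<^sub>M noise_law)"
  interpret R: prob_space R unfolding R_def by (intro prob_space_pair) unfold_locales
  define \<pi> where "\<pi> = \<mu> \<Otimes>\<^sub>M noise_law"
  \<comment> \<open>A point of R consists of a spare start v and a pair (w, e). X keeps (w, e), Y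
    exchanges the start for v; both have the stationary law \<pi> and share the noise e.\<close>
  define X where "X = (\<lambda>r :: real vec \<times> real vec \<times> (nat \<Rightarrow> real). snd r)"
  define Y where "Y = (\<lambda>r :: real vec \<times> real vec \<times> (nat \<Rightarrow> real). (fst r, snd (snd r)))"
  have sets_\<pi>: "sets \<pi> = sets (vec_borel p \<Otimes>\<^sub>M noise_space)"
    unfolding \<pi>_def by (intro sets_pair_measure_cong sets_noise_law sets_\<mu>)
  have X[measurable]: "X \<in> measurable R (vec_borel p \<Otimes>\<^sub>M noise_space)" and Y[measurable]: "Y \<in> measurable R (vec_borel p \<Otimes>\<^sub>M noise_space)"
    unfolding X_def Y_def R_def by measurable
  have distr_X: "distr R (vec_borel p \<Otimes>\<^sub>M noise_space) X = \<pi>"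
  proof -
    have "distr R (vec_borel p \<Otimes>\<^sub>M noise_space) X = distr R \<pi> snd"
      by (rule distr_cong) (auto simp: sets_\<pi> X_def)
    also have "\<dots> = \<pi>"
      unfolding R_def \<pi>_def[symmetric]
    proof (rule measure_eqI)
      fix C assume "C \<in> sets (distr (\<mu> \<Otimes>\<^sub>M \<pi>) \<pi> snd)"
      then have C: "C \<in> sets \<pi>" by simp
      have "emeasure (distr (\<mu> \<Otimes>\<^sub>M \<pi>) \<pi> snd) C = emeasure (\<mu> \<Otimes>\<^sub>M \<pi>) (space \<mu> \<times> C)"
        using C sets.sets_into_space[OF C]
        by (subst emeasure_distr) (auto simp: space_pair_measure intro!: arg_cong[where f = "emeasure _"])
      also have "\<dots> = emeasure \<pi> C"
        using C \<mu>.emeasure_space_1 unfolding \<pi>_def by (subst \<pi>.emeasure_pair_measure_Times) auto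
      finally show "emeasure (distr (\<mu> \<Otimes>\<^sub>M \<pi>) \<pi> snd) C = emeasure \<pi> C" .
    qed simp
    finally show ?thesis .
  qed
  have distr_Y: "distr R (vec_borel p \<Otimes>\<^sub>M noise_space) Y = \<pi>"
  proof -
    have snd_law: "distr \<pi> noise_law snd = noise_law"
    proof (rule measure_eqI)
      fix C assume "C \<in> sets (distr \<pi> noise_law snd)"
      then have C: "C \<in> sets noise_law" by simp
      have "emeasure (distr \<pi> noise_law snd) C = emeasure (\<mu> \<Otimes>\<^sub>M noise_law) (space \<mu> \<times> C)"
        unfolding \<pi>_def using C sets.sets_into_space[OF C]
        by (subst emeasure_distr) (auto simp: space_pair_measure intro!: arg_cong[where f = "emeasure _"])
      also have "\<dots> = emeasure noise_law C"
        using C \<mu>.emeasure_space_1 by (subst N.emeasure_pair_measure_Times) auto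
      finally show "emeasure (distr \<pi> noise_law snd) C = emeasure noise_law C" .
    qed simp
    have "distr \<mu> \<mu> (\<lambda>v. v) \<Otimes>\<^sub>M distr \<pi> noise_law snd = distr (\<mu> \<Otimes>\<^sub>M \<pi>) (\<mu> \<Otimes>\<^sub>M noise_law) (\<lambda>(v, x). (v, snd x))"
      by (rule pair_measure_distr) (auto simp: snd_law N.sigma_finite_measure_axioms, simp add: \<pi>_def)
    also have "\<dots> = distr R (vec_borel p \<Otimes>\<^sub>M noise_space) Y"
      by (rule distr_cong) (use sets_\<pi> in \<open>auto simp: R_def \<pi>_def Y_def\<close>)
    finally show ?thesis using snd_law by (simp add: \<pi>_def)
  qed
  define Q where "Q = distr \<pi> (path_space p) (ar_path p A s)"
  note tail = ar_path_tail_law[OF A law, folded \<pi>_def Q_def]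
  define x where "x m r n = ar_path p A s (X r) (n + m)" for m r n
  define y where "y m r n = ar_path p A s (Y r) (n + m)" for m r n
  have els: "equal_law_sequences R (path_space p) Q x y"
  proof
    fix m
    have x_eq: "x m = (\<lambda>x n. ar_path p A s x (n + m)) \<circ> X" by (simp add: x_def[abs_def] comp_def)
    have y_eq: "y m = (\<lambda>x n. ar_path p A s x (n + m)) \<circ> Y" by (simp add: y_def[abs_def] comp_def)
    show "x m \<in> measurable R (path_space p)" unfolding x_eq by (rule measurable_comp[OF X tail(1)])
    show "y m \<in> measurable R (path_space p)" unfolding y_eq by (rule measurable_comp[OF Y tail(1)])
    show "distr R (path_space p) (x m) = Q" unfolding x_eq by (simp add: distr_distr[OF tail(1) X, symmetric] distr_X tail(2))
    show "distr R (path_space p) (y m) = Q" unfolding y_eq by (simp add: distr_distr[OF tail(1) Y, symmetric] distr_Y tail(2))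
  qed
  then interpret els: equal_law_sequences R "path_space p" Q x y .
  have lim: "(\<lambda>m. measure R {r \<in> space R. (x m r \<in> B) \<noteq> (y m r \<in> B)}) \<longlonglongrightarrow> 0"
  proof (rule coupled_paths[OF els _ B])
    fix n j assume j: "j < p"
    have "(\<lambda>m. x m r n $ j - y m r n $ j) \<longlonglongrightarrow> 0" if r: "r \<in> space R" for r
    proof -
      obtain v w e where "r = (v, w, e)" by (cases r) auto
      then have "v \<in> carrier_vec p" "w \<in> carrier_vec p" using r by (auto simp: R_def space_pair_measure space_\<mu>)
      from LIMSEQ_ignore_initial_segment[OF ar_path_diff_tendsto_0[OF A p stable this(2,1) j, of s e], of n]
      show ?thesis by (simp add: x_def y_def X_def Y_def \<open>r = _\<close> add.commute)
    qed
    then show "AE r in R. (\<lambda>m. x m r n $ j - y m r n $ j) \<longlonglongrightarrow> 0" by simp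
  qed
  \<comment> \<open>Invariance of B is an equality of sets, so membership of a path and of its shift
    agree at every point, not merely almost surely.\<close>
  have const: "{r \<in> space R. (x m r \<in> B) \<noteq> (y m r \<in> B)} = {r \<in> space R. (x 0 r \<in> B) \<noteq> (y 0 r \<in> B)}" for m
  proof (induction m)
    case (Suc m)
    have shift: "w \<in> B \<longleftrightarrow> (\<lambda>n. w (Suc n)) \<in> B" if "w \<in> space (path_space p)" for w
      using inv that by blast
    have "(\<lambda>n. x m r (Suc n)) = x (Suc m) r" "(\<lambda>n. y m r (Suc n)) = y (Suc m) r" for r by (simp_all add: x_def y_def fun_eq_iff)
    then have "x (Suc m) r \<in> B \<longleftrightarrow> x m r \<in> B" "y (Suc m) r \<in> B \<longleftrightarrow> y m r \<in> B" if "r \<in> space R" for r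
      using shift[of "x m r"] shift[of "y m r"] measurable_space[OF els.x_meas that] measurable_space[OF els.y_meas that] by auto
    then show ?case using Suc by auto
  qed simp
  have "measure R {r \<in> space R. (x 0 r \<in> B) \<noteq> (y 0 r \<in> B)} = 0"
    by (rule LIMSEQ_unique[OF _ lim]) (subst const, rule tendsto_const)
  moreover have "{r \<in> space R. (x 0 r \<in> B) \<noteq> (y 0 r \<in> B)} \<in> sets R"
    using els.x_meas[of 0] els.y_meas[of 0] B by measurable
  ultimately have "AE r in R. (x 0 r \<in> B) = (y 0 r \<in> B)"
    by (intro AE_I[where N = "{r \<in> space R. (x 0 r \<in> B) \<noteq> (y 0 r \<in> B)}"]) (auto simp: R.emeasure_eq_measure)
  moreover have "x 0 r = ar_path p A s (snd r)" "y 0 r = ar_path p A s (fst r, snd (snd r))" for r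
    by (simp_all add: x_def y_def X_def Y_def fun_eq_iff)
  ultimately show ?thesis unfolding R_def by simp
qed

section \<open>Stationarity and ergodicity of the autoregression\<close>

lemma (in prob_space) indep_vars_Suc:
  assumes "indep_vars (\<lambda>_. N) X {1..}"
  shows "indep_vars (\<lambda>_. N) (\<lambda>n. X (Suc n)) UNIV"
proof -
  have rv: "X n \<in> measurable M N" if "n \<ge> 1" for n using assms that by (auto simp: indep_vars_def)
  have ind: "indep_sets (\<lambda>i. {X i -` A \<inter> space M |A. A \<in> sets N}) {1..}"
    using assms by (simp add: indep_vars_def2)
  have "indep_sets (\<lambda>i. {X (Suc i) -` A \<inter> space M |A. A \<in> sets N}) UNIV"
  proof (rule indep_setsI)
    show "{X (Suc i) -` A \<inter> space M |A. A \<in> sets N} \<subseteq> events" for i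
      using rv[of "Suc i"] by (auto intro: measurable_sets)
    fix A :: "nat \<Rightarrow> 'a set" and J assume J: "J \<noteq> {}" "J \<subseteq> UNIV" "finite J"
      and A: "\<forall>j\<in>J. A j \<in> {X (Suc j) -` A \<inter> space M |A. A \<in> sets N}"
    have "prob (\<Inter>j\<in>Suc ` J. A (j - 1)) = (\<Prod>j\<in>Suc ` J. prob (A (j - 1)))"
      using J A by (intro indep_setsD[OF ind]) auto
    then show "prob (\<Inter>j\<in>J. A j) = (\<Prod>j\<in>J. prob (A j))"
      by (simp add: prod.reindex)
  qed
  then show ?thesis using rv by (simp add: indep_vars_def2)
qed

locale stationary_ar = prob_space M for M :: "'w measure" +
  fixes \<epsilon> :: "nat \<Rightarrow> 'w \<Rightarrow> real" and \<gamma> :: "nat \<Rightarrow> 'w \<Rightarrow> real vec" and p :: nat and A :: "real mat" and s :: real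
  assumes A: "A \<in> carrier_mat p p" and p: "p > 0"
    and stable: "spectral_radius (map_mat complex_of_real A) < 1"
    and eps_indep: "indep_vars (\<lambda>_. borel) \<epsilon> {1..}"
    and eps_normal: "\<And>n. n \<ge> 1 \<Longrightarrow> distributed M lborel (\<epsilon> n) std_normal_density"
    and gamma_measurable: "\<And>n. \<gamma> n \<in> measurable M (vec_borel p)"
    and gamma_rec: "\<And>n. n \<ge> 1 \<Longrightarrow> AE \<omega> in M. \<gamma> n \<omega> = ar_step p A s (\<gamma> (n - 1) \<omega>) (\<epsilon> n \<omega>)"
    and gamma_0_law: "ar_stationary_law p A s (distr M (vec_borel p) (\<gamma> 0))"
    and gamma_0_indep: "indep_set (sets (vimage_algebra (space M) (\<gamma> 0) (vec_borel p)))
         (sets (vimage_algebra (space M) (\<lambda>\<omega> n. \<epsilon> (Suc n) \<omega>) noise_space))"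
begin

definition \<mu> :: "real vec measure" where "\<mu> = distr M (vec_borel p) (\<gamma> 0)"

text \<open>The present value together with all noise still to come: almost surely the future of
  \<gamma> is \<open>ar_path\<close> of it, at every time m.\<close>

definition state :: "nat \<Rightarrow> 'w \<Rightarrow> real vec \<times> (nat \<Rightarrow> real)" where
  "state m \<omega> = (\<gamma> m \<omega>, \<lambda>n. \<epsilon> (Suc (n + m)) \<omega>)"

lemma eps_measurable: "\<epsilon> (Suc n) \<in> borel_measurable M"
  using distributed_measurable[OF eps_normal[of "Suc n"]] by simp

lemma noise_measurable: "(\<lambda>\<omega> n. \<epsilon> (Suc (n + m)) \<omega>) \<in> measurable M noise_space"
  by (rule measurable_PiM_single') (auto simp: eps_measurable space_PiM)

lemma state_measurable: "state m \<in> measurable M (vec_borel p \<Otimes>\<^sub>M noise_space)"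
  unfolding state_def[abs_def] by (intro measurable_Pair gamma_measurable noise_measurable)

lemma noise_distr: "distr M noise_space (\<lambda>\<omega> n. \<epsilon> (Suc n) \<omega>) = noise_law"
proof -
  have "distr M (\<Pi>\<^sub>M i\<in>UNIV. borel) (\<lambda>x. \<lambda>i\<in>UNIV. \<epsilon> (Suc i) x) = (\<Pi>\<^sub>M i\<in>UNIV. distr M borel (\<epsilon> (Suc i)))"
    using indep_vars_Suc[OF eps_indep] eps_measurable by (subst (asm) indep_vars_iff_distr_eq_PiM') auto
  moreover have "distr M borel (\<epsilon> (Suc i)) = std_normal" for i
  proof -
    have "distr M borel (\<epsilon> (Suc i)) = distr M lborel (\<epsilon> (Suc i))" by (rule distr_cong) auto
    then show ?thesis using distributed_distr_eq_density[OF eps_normal[of "Suc i"]] by simp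
  qed
  ultimately show ?thesis by (simp add: restrict_def)
qed

lemma state_0_law: "distr M (vec_borel p \<Otimes>\<^sub>M noise_space) (state 0) = \<mu> \<Otimes>\<^sub>M noise_law"
proof -
  let ?E = "\<lambda>\<omega> n. \<epsilon> (Suc n) \<omega>"
  have E: "?E \<in> measurable M noise_space" using noise_measurable[of 0] by simp
  interpret G: prob_space \<mu> unfolding \<mu>_def by (rule prob_space_distr[OF gamma_measurable])
  interpret N: prob_space noise_law by (rule prob_space_noise_law)
  have "\<mu> \<Otimes>\<^sub>M noise_law = distr M (vec_borel p \<Otimes>\<^sub>M noise_space) (state 0)"
  proof (rule pair_measure_eqI)
    show "sigma_finite_measure \<mu>" "sigma_finite_measure noise_law" by unfold_locales
    have "sets (\<mu> \<Otimes>\<^sub>M noise_law) = sets (vec_borel p \<Otimes>\<^sub>M noise_space)"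
      by (intro sets_pair_measure_cong sets_noise_law) (simp add: \<mu>_def)
    then show "sets (\<mu> \<Otimes>\<^sub>M noise_law) = sets (distr M (vec_borel p \<Otimes>\<^sub>M noise_space) (state 0))" by simp
    fix C D assume "C \<in> sets \<mu>" "D \<in> sets noise_law"
    then have C: "C \<in> sets (vec_borel p)" and D: "D \<in> sets noise_space" by (simp_all add: \<mu>_def sets_noise_law)
    have "\<gamma> 0 -` C \<inter> space M \<in> sets (vimage_algebra (space M) (\<gamma> 0) (vec_borel p))"
      "?E -` D \<inter> space M \<in> sets (vimage_algebra (space M) ?E noise_space)"
      by (rule in_vimage_algebra[OF C], rule in_vimage_algebra[OF D])
    from indep_setD[OF gamma_0_indep this]
    have "prob ((\<gamma> 0 -` C \<inter> space M) \<inter> (?E -` D \<inter> space M)) = prob (\<gamma> 0 -` C \<inter> space M) * prob (?E -` D \<inter> space M)" .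
    moreover have "state 0 -` (C \<times> D) \<inter> space M = (\<gamma> 0 -` C \<inter> space M) \<inter> (?E -` D \<inter> space M)"
      by (auto simp: state_def)
    moreover have "emeasure noise_law D = emeasure M (?E -` D \<inter> space M)"
      unfolding noise_distr[symmetric] by (rule emeasure_distr[OF E D])
    moreover have "emeasure \<mu> C = emeasure M (\<gamma> 0 -` C \<inter> space M)"
      unfolding \<mu>_def by (rule emeasure_distr[OF gamma_measurable C])
    moreover have "emeasure (distr M (vec_borel p \<Otimes>\<^sub>M noise_space) (state 0)) (C \<times> D) = emeasure M (state 0 -` (C \<times> D) \<inter> space M)"
      by (rule emeasure_distr[OF state_measurable pair_measureI[OF C D]])
    ultimately show "emeasure \<mu> C * emeasure noise_law D = emeasure (distr M (vec_borel p \<Otimes>\<^sub>M noise_space) (state 0)) (C \<times> D)"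
      by (simp add: emeasure_eq_measure ennreal_mult)
  qed
  then show ?thesis ..
qed

lemma state_Suc: "AE \<omega> in M. state (Suc m) \<omega> = ar_shift p A s (state m \<omega>)"
  using gamma_rec[of "Suc m"] by (auto simp: state_def ar_shift_def)

lemma state_law: "distr M (vec_borel p \<Otimes>\<^sub>M noise_space) (state m) = \<mu> \<Otimes>\<^sub>M noise_law"
proof (induction m)
  case (Suc m)
  have "distr M (vec_borel p \<Otimes>\<^sub>M noise_space) (state (Suc m)) = distr M (vec_borel p \<Otimes>\<^sub>M noise_space) (ar_shift p A s \<circ> state m)"
    using state_Suc[of m] state_measurable measurable_comp[OF state_measurable measurable_ar_shift[OF A]]
    by (intro distr_cong_AE) (auto simp: comp_def)
  also have "\<dots> = distr (distr M (vec_borel p \<Otimes>\<^sub>M noise_space) (state m)) (vec_borel p \<Otimes>\<^sub>M noise_space) (ar_shift p A s)"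
    by (rule distr_distr[symmetric, OF measurable_ar_shift[OF A] state_measurable])
  also have "\<dots> = \<mu> \<Otimes>\<^sub>M noise_law"
    unfolding Suc by (rule distr_ar_shift[OF A]) (simp add: \<mu>_def gamma_0_law)
  finally show ?case .
qed (rule state_0_law)

lemma gamma_path: "AE \<omega> in M. \<forall>m. (\<lambda>n. \<gamma> (n + m) \<omega>) = ar_path p A s (state m \<omega>)"
proof -
  have "AE \<omega> in M. \<forall>n. \<gamma> (Suc n) \<omega> = ar_step p A s (\<gamma> n \<omega>) (\<epsilon> (Suc n) \<omega>)"
    unfolding AE_all_countable using gamma_rec[of "Suc _"] by simp
  then show ?thesis
  proof eventually_elim
    case (elim \<omega>)
    have "\<gamma> (n + m) \<omega> = ar_path p A s (state m \<omega>) n" for n m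
      by (induction n) (auto simp: state_def elim)
    then show ?case by blast
  qed
qed

lemma gamma_path_measurable: "(\<lambda>\<omega> n. \<gamma> (n + m) \<omega>) \<in> measurable M (path_space p)"
proof (rule measurable_PiM_single'[OF gamma_measurable])
  show "(\<lambda>\<omega> n. \<gamma> (n + m) \<omega>) \<in> space M \<rightarrow> (\<Pi>\<^sub>E i\<in>UNIV. space (vec_borel p))"
    using measurable_space[OF gamma_measurable] by (auto simp: PiE_UNIV_domain)
qed

lemma gamma_strictly_stationary: "strictly_stationary M (vec_borel p) \<gamma>"
proof -
  have "distr M (path_space p) (\<lambda>\<omega> n. \<gamma> (n + m) \<omega>) = distr (\<mu> \<Otimes>\<^sub>M noise_law) (path_space p) (ar_path p A s)" for m
  proof -
    have "distr M (path_space p) (\<lambda>\<omega> n. \<gamma> (n + m) \<omega>) = distr M (path_space p) (ar_path p A s \<circ> state m)"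
      using gamma_path gamma_path_measurable measurable_comp[OF state_measurable measurable_ar_path[OF A]]
      by (intro distr_cong_AE) auto
    then show ?thesis by (simp only: distr_distr[symmetric, OF measurable_ar_path[OF A] state_measurable] state_law)
  qed
  from this this[of 0] show ?thesis using gamma_measurable by (simp add: strictly_stationary_def)
qed

text \<open>In an \<open>infinitely often\<close> statement the first k indices can be skipped, so
  for each k the event is measurable for the innovations from index k on.\<close>

lemma tail_event_prob:
  assumes H: "H \<in> sets noise_space"
  shows "prob {\<omega> \<in> space M. \<forall>j. \<exists>m\<ge>j. (\<lambda>n. \<epsilon> (Suc (n + m)) \<omega>) \<in> H} \<in> {0, 1}" (is "prob ?L \<in> _")
proof -
  define F where "F i = sets (vimage_algebra (space M) (\<epsilon> (Suc i)) borel)" for i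
  have F: "F i = {\<epsilon> (Suc i) -` S \<inter> space M |S. S \<in> sets borel}" for i
    unfolding F_def by (rule sets_vimage_algebra2) simp
  have "prob ?L = 0 \<or> prob ?L = 1"
  proof (rule kolmogorov_0_1_law)
    show "sigma_algebra (space M) (F i)" for i
      using sets.sigma_algebra_axioms[of "vimage_algebra (space M) (\<epsilon> (Suc i)) borel"] by (simp add: F_def)
    show "indep_sets F UNIV"
      using indep_vars_Suc[OF eps_indep] unfolding indep_vars_def2 F[abs_def] by simp
    show "?L \<in> tail_events F"
      unfolding tail_events_def
    proof
      fix k
      define T where "T = sigma (space M) (\<Union>i\<in>{k..}. F i)"
      have sub: "(\<Union>i\<in>{k..}. F i) \<subseteq> Pow (space M)" by (auto simp: F)
      have T: "space T = space M" "sets T = sigma_sets (space M) (\<Union>i\<in>{k..}. F i)"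
        using sub by (simp_all add: T_def)
      have "\<epsilon> (Suc i) \<in> borel_measurable T" if "i \<ge> k" for i
      proof (rule measurableI)
        fix S :: "real set" assume "S \<in> sets borel"
        then have "\<epsilon> (Suc i) -` S \<inter> space M \<in> (\<Union>i\<in>{k..}. F i)" using that by (auto simp: F)
        then show "\<epsilon> (Suc i) -` S \<inter> space T \<in> sets T" unfolding T by (rule sigma_sets.Basic)
      qed simp
      then have "(\<lambda>\<omega> n. \<epsilon> (Suc (n + (m + k))) \<omega>) \<in> measurable T noise_space" for m
        by (intro measurable_PiM_single') (auto simp: space_PiM)
      from measurable_sets[OF this H]
      have ev: "{\<omega> \<in> space T. (\<lambda>n. \<epsilon> (Suc (n + (m + k))) \<omega>) \<in> H} \<in> sets T" for m
        by (simp add: vimage_def Int_def conj_commute)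
      have "?L = {\<omega> \<in> space T. \<forall>j. \<exists>m\<in>{j..}. (\<lambda>n. \<epsilon> (Suc (n + (m + k))) \<omega>) \<in> H}"
      proof -
        have "(\<forall>j. \<exists>m\<ge>j. P m) \<longleftrightarrow> (\<forall>j. \<exists>m\<in>{j..}. P (m + k))" for P :: "nat \<Rightarrow> bool"
        proof
          assume P: "\<forall>j. \<exists>m\<ge>j. P m"
          show "\<forall>j. \<exists>m\<in>{j..}. P (m + k)"
          proof
            fix j
            from P obtain m where "m \<ge> j + k" "P m" by blast
            then show "\<exists>m\<in>{j..}. P (m + k)" by (intro bexI[of _ "m - k"]) auto
          qed
        next
          assume "\<forall>j. \<exists>m\<in>{j..}. P (m + k)"
          then show "\<forall>j. \<exists>m\<ge>j. P m" by (meson atLeast_iff trans_le_add1)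
        qed
        then show ?thesis by (simp add: T)
      qed
      also have "\<dots> \<in> sets T"
        by (intro sets.sets_Collect_countable_All sets.sets_Collect_countable_Ex' ev) auto
      finally show "?L \<in> sigma_sets (space M) (\<Union> (F ` {k..}))" by (simp add: T)
    qed
  qed
  then show ?thesis by simp
qed

lemma gamma_ergodic: "ergodic_process M (vec_borel p) \<gamma>"
  unfolding ergodic_process_def
proof (intro ballI impI)
  fix B assume B: "B \<in> sets (path_space p)"
    and inv: "(\<lambda>x n. x (Suc n)) -` B \<inter> space (path_space p) = B"
  have law: "ar_stationary_law p A s \<mu>" by (simp add: \<mu>_def gamma_0_law)
  then have sets_\<mu>: "sets \<mu> = sets (vec_borel p)" and \<mu>: "prob_space \<mu>" by (auto simp: ar_stationary_law_def)
  interpret \<mu>: prob_space \<mu> by fact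
  interpret N: prob_space noise_law by (rule prob_space_noise_law)
  interpret \<pi>: prob_space "\<mu> \<Otimes>\<^sub>M noise_law" by (intro prob_space_pair) unfold_locales
  interpret R: pair_sigma_finite \<mu> "\<mu> \<Otimes>\<^sub>M noise_law" ..
  \<comment> \<open>By Fubini, for almost every fixed start v the noise alone decides, up to null
    sets, whether a stationary path lies in B. One such deterministic v is kept.\<close>
  have "AE v in \<mu>. AE x in \<mu> \<Otimes>\<^sub>M noise_law. (ar_path p A s x \<in> B) = (ar_path p A s (v, snd x) \<in> B)"
    using R.AE_pair[OF ar_path_invariant_forgets_start[OF A p stable law B inv]] by simp
  then have ae: "AE v in \<mu>. v \<in> space \<mu> \<and> (AE x in \<mu> \<Otimes>\<^sub>M noise_law. (ar_path p A s x \<in> B) = (ar_path p A s (v, snd x) \<in> B))"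
    by simp
  have "\<exists>v. v \<in> space \<mu> \<and> (AE x in \<mu> \<Otimes>\<^sub>M noise_law. (ar_path p A s x \<in> B) = (ar_path p A s (v, snd x) \<in> B))"
    by (rule eventually_happens'[OF \<mu>.ae_filter_bot ae])
  then obtain v where v: "v \<in> carrier_vec p"
    and AE_v: "AE x in \<mu> \<Otimes>\<^sub>M noise_law. (ar_path p A s x \<in> B) = (ar_path p A s (v, snd x) \<in> B)"
    using sets_eq_imp_space_eq[OF sets_\<mu>] by auto
  define H where "H = {e \<in> space noise_space. ar_path p A s (v, e) \<in> B}"
  have "(\<lambda>e. ar_path p A s (v, e)) \<in> measurable noise_space (path_space p)"
    using v by (intro measurable_compose[OF _ measurable_ar_path[OF A]] measurable_Pair) auto
  from measurable_sets[OF this B] have H: "H \<in> sets noise_space"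
    by (simp add: H_def vimage_def Int_def conj_commute)
  \<comment> \<open>Every state has the same law, so the same v serves all m, and countably many
    null sets are discarded.\<close>
  have "AE \<omega> in M. \<forall>m. (ar_path p A s (state m \<omega>) \<in> B) = (ar_path p A s (v, snd (state m \<omega>)) \<in> B)"
    unfolding AE_all_countable
  proof
    fix m
    have "AE x in distr M (vec_borel p \<Otimes>\<^sub>M noise_space) (state m). (ar_path p A s x \<in> B) = (ar_path p A s (v, snd x) \<in> B)"
      unfolding state_law by (rule AE_v)
    then show "AE \<omega> in M. (ar_path p A s (state m \<omega>) \<in> B) = (ar_path p A s (v, snd (state m \<omega>)) \<in> B)"
      by (rule AE_distrD[OF state_measurable])
  qed
  then have AE_H: "AE \<omega> in M. \<forall>m. ((\<lambda>n. \<gamma> n \<omega>) \<in> B) = ((\<lambda>n. \<epsilon> (Suc (n + m)) \<omega>) \<in> H)"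
    using gamma_path AE_space
  proof eventually_elim
    case (elim \<omega>)
    have shift: "w \<in> B \<longleftrightarrow> (\<lambda>n. w (Suc n)) \<in> B" if "w \<in> space (path_space p)" for w
      using inv that by blast
    have "((\<lambda>n. \<gamma> n \<omega>) \<in> B) = ((\<lambda>n. \<gamma> (n + m) \<omega>) \<in> B)" for m
    proof (induction m)
      case (Suc m)
      then show ?case using shift[OF measurable_space[OF gamma_path_measurable elim(3)], of m] by simp
    qed simp
    then show ?case using elim measurable_space[OF noise_measurable elim(3)]
      by (simp add: H_def state_def)
  qed
  \<comment> \<open>Almost surely the shifted noise lies in H for all m or for none. The
    \<open>infinitely often\<close> form has the same probability and is a tail event without
    exceptional sets.\<close>
  let ?L = "{\<omega> \<in> space M. \<forall>j. \<exists>m\<ge>j. (\<lambda>n. \<epsilon> (Suc (n + m)) \<omega>) \<in> H}"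
  have "prob {\<omega> \<in> space M. (\<lambda>n. \<gamma> n \<omega>) \<in> B} = prob ?L"
  proof (rule finite_measure_eq_AE)
    show "AE \<omega> in M. (\<omega> \<in> {\<omega> \<in> space M. (\<lambda>n. \<gamma> n \<omega>) \<in> B}) = (\<omega> \<in> ?L)"
      using AE_H by eventually_elim auto
    show "{\<omega> \<in> space M. (\<lambda>n. \<gamma> n \<omega>) \<in> B} \<in> events"
      using measurable_sets[OF gamma_path_measurable[of 0] B] by (simp add: vimage_def Int_def conj_commute)
    have ev: "{\<omega> \<in> space M. (\<lambda>n. \<epsilon> (Suc (n + m)) \<omega>) \<in> H} \<in> events" for m
      using measurable_sets[OF noise_measurable H, of m] by (simp add: vimage_def Int_def conj_commute)
    have "{\<omega> \<in> space M. \<forall>j. \<exists>m\<in>{j..}. (\<lambda>n. \<epsilon> (Suc (n + m)) \<omega>) \<in> H} \<in> events"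
      by (intro sets.sets_Collect_countable_All sets.sets_Collect_countable_Ex' ev) auto
    then show "?L \<in> events" by (simp only: Bex_def atLeast_iff)
  qed
  then show "prob {\<omega> \<in> space M. (\<lambda>n. \<gamma> n \<omega>) \<in> B} \<in> {0, 1}"
    using tail_event_prob[OF H] by simp
qed

end

section \<open>Convergence to the stationary autoregression\<close>

lemma l1_norm_mult_mat_vec_le:
  assumes A: "A \<in> carrier_mat p p" and t: "0 \<le> t" "t \<le> 1" and c: "c \<ge> 0" and w: "w \<in> carrier_vec p"
    and bound: "\<And>k v. v \<in> carrier_vec p \<Longrightarrow> l1_norm (A ^\<^sub>m k *\<^sub>v v) \<le> c * t ^ k * l1_norm v"
  shows "l1_norm (A *\<^sub>v w) \<le> c * l1_norm w"
proof -
  have "A ^\<^sub>m 1 = A" using A by simp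
  then have "l1_norm (A *\<^sub>v w) \<le> c * t * l1_norm w" using bound[OF w, of 1] by simp
  also have "\<dots> \<le> c * 1 * l1_norm w" using t c by (intro mult_right_mono mult_left_mono) auto
  finally show ?thesis by simp
qed

text \<open>The same linear recursion is used twice. Driven by \<sigma> e it bounds Z and yields
  \<beta> W \<rightarrow> 0. For the difference of Z and \<gamma> the scalar input is (\<sigma> -
  \<sigma>') e, so the whole input is then known to vanish.\<close>

lemma (in levinson) zeta_approaches_gamma:
  fixes x e :: "nat \<Rightarrow> real" and \<gamma> :: "nat \<Rightarrow> real vec" and \<sigma> :: "nat \<Rightarrow> real"
  assumes p: "p \<ge> 1" and stable: "spectral_radius (map_mat complex_of_real (companion p \<theta>)) < 1"
    and innov: "\<And>n. n \<ge> 1 \<Longrightarrow> (\<Sum>i=1..n. k n i * x i) = \<sigma> n * e n"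
    and gamma: "\<And>n. \<gamma> (Suc n) = ar_step p (companion p \<theta>) \<sigma>' (\<gamma> n) (e (Suc n))"
    and gamma_carrier: "\<And>n. \<gamma> n \<in> carrier_vec p"
    and e: "\<And>n. \<bar>e (Suc n)\<bar> \<le> G * (real n + 1) powr \<delta>" and \<delta>: "\<delta> > 0"
    and \<sigma>_bound: "\<And>n. n \<ge> 1 \<Longrightarrow> \<bar>\<sigma> n\<bar> \<le> S"
    and \<sigma>_rate: "\<And>n. n \<ge> 1 \<Longrightarrow> \<bar>\<sigma> n - \<sigma>'\<bar> \<le> D * real n powr (- 2 * \<delta>)"
    and b_sum: "summable (\<lambda>n. (pacf k (Suc n))\<^sup>2)"
    and b_bound: "(\<lambda>n. pacf k (Suc n)) \<in> O(\<lambda>n. real n powr (- (1/2 + 2 * \<delta>)))"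
  shows "(\<lambda>n. eucl_norm (vec_first (ar_zeta p \<theta> k x n) p - \<gamma> n)) \<longlonglongrightarrow> 0"
proof -
  let ?A = "companion p \<theta>"
  have A: "?A \<in> carrier_mat p p" by simp
  have p0: "p > 0" using p by simp
  obtain t c where t: "0 < t" "t < 1" and c: "c \<ge> 0"
    and bound: "\<And>k v. v \<in> carrier_vec p \<Longrightarrow> l1_norm (?A ^\<^sub>m k *\<^sub>v v) \<le> c * t ^ k * l1_norm v"
    by (rule stable_matrix_power_bound[OF A p0 stable, of thesis]) (rule that)
  \<comment> \<open>Everything is shifted by one, since the recursions hold from index 1 on; the
    conventional value \<open>pacf k 0 = 1\<close> stays outside.\<close>
  define b where "b n = pacf k (Suc n)" for n
  define Z where "Z n = ar_Z p \<theta> k x (Suc n)" for n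
  define W where "W n = ar_W p \<theta> k x (Suc n)" for n
  have Z: "Z n \<in> carrier_vec p" and W: "W n \<in> carrier_vec p" for n by (simp_all add: Z_def W_def)
  have AW: "?A *\<^sub>v W n \<in> carrier_vec p" for n by (rule mult_mat_vec_carrier[OF A W])
  have l1_AW: "l1_norm (?A *\<^sub>v W n) \<le> c * l1_norm (W n)" for n
    using t by (intro l1_norm_mult_mat_vec_le[OF A _ _ c W bound]) auto
  \<comment> \<open>The scalar input r is left open so that \<open>l1_h\<close> covers both uses of
    the recursion.\<close>
  define h where "h r n = b n \<cdot>\<^sub>v (?A *\<^sub>v W n) + r n \<cdot>\<^sub>v unit_vec p 0" for r :: "nat \<Rightarrow> real" and n
  have h: "h r n \<in> carrier_vec p" for r n using AW[of n] by (simp add: h_def)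
  have l1_h: "l1_norm (h r n) \<le> c * \<bar>b n\<bar> * l1_norm (W n) + \<bar>r n\<bar>" for r n
  proof -
    have "l1_norm (h r n) \<le> l1_norm (b n \<cdot>\<^sub>v (?A *\<^sub>v W n)) + l1_norm (r n \<cdot>\<^sub>v unit_vec p 0)"
      unfolding h_def by (rule l1_norm_triangle) (use AW in auto)
    also have "\<dots> = \<bar>b n\<bar> * l1_norm (?A *\<^sub>v W n) + \<bar>r n\<bar>"
      by (simp add: l1_norm_smult l1_norm_unit_vec[OF p0])
    also have "\<bar>b n\<bar> * l1_norm (?A *\<^sub>v W n) \<le> \<bar>b n\<bar> * (c * l1_norm (W n))"
      by (intro mult_left_mono l1_AW) simp
    finally show ?thesis by (simp add: mult_ac)
  qed
  define r where "r n = \<sigma> (Suc (Suc n)) * e (Suc (Suc n))" for n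
  define r' where "r' n = (\<sigma> (Suc (Suc n)) - \<sigma>') * e (Suc (Suc n))" for n
  have Z_rec: "Z (Suc n) = ?A *\<^sub>v Z n + h r n" for n
    using ar_Z_Suc[of "Suc n" p \<theta> x] innov[of "Suc (Suc n)"] p
    by (simp only: Z_def W_def h_def b_def r_def)
  have W_rec: "W (Suc n) = W n + b n \<cdot>\<^sub>v Z n" for n
    using ar_W_Suc[of "Suc n"] by (simp add: W_def Z_def b_def)

  define y where "y = rec_nat (l1_norm (Z 0)) (\<lambda>n a. t * a + l1_norm (h r n))"
  \<comment> \<open>The majorant y, not the norm of Z, enters \<open>coupled_rec_tendsto_0\<close>:
    the norm of Z need not satisfy an inequality with the factor t.\<close>
  have y_0: "y 0 = l1_norm (Z 0)" and y_Suc: "y (Suc n) = t * y n + l1_norm (h r n)" for n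
    by (simp_all add: y_def)
  have Z_y: "l1_norm (Z n) \<le> c * y n" for n
    by (rule affine_rec_norm_bound[OF A c bound, where x = Z and u = "h r" and y = y])
      (rule Z h Z_rec y_Suc less_imp_le[OF t(1)] order.refl | simp only: y_0)+
  have y_nonneg: "y n \<ge> 0" for n using t by (induction n) (simp_all add: y_0 y_Suc)
  have l1_W: "l1_norm (W n) \<le> c * (\<Sum>m<n. \<bar>b m\<bar> * y m)" for n
  proof (induction n)
    case 0
    then show ?case by (simp add: W_def ar_W_def l1_norm_def)
  next
    case (Suc n)
    have "l1_norm (W (Suc n)) \<le> l1_norm (W n) + \<bar>b n\<bar> * l1_norm (Z n)"
      unfolding W_rec l1_norm_smult[symmetric] by (rule l1_norm_triangle) (use W Z in auto)
    also have "\<dots> \<le> c * (\<Sum>m<n. \<bar>b m\<bar> * y m) + \<bar>b n\<bar> * (c * y n)"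
      by (intro add_mono Suc mult_left_mono Z_y) simp
    finally show ?case by (simp add: algebra_simps)
  qed
  have S0: "S \<ge> 0" using \<sigma>_bound[of 1] by simp
  have e': "\<bar>e (Suc (Suc n))\<bar> \<le> \<bar>G\<bar> * (real (Suc (Suc n))) powr \<delta>" for n
  proof -
    have "\<bar>e (Suc (Suc n))\<bar> \<le> G * (real (Suc n) + 1) powr \<delta>" by (rule e)
    also have "\<dots> \<le> \<bar>G\<bar> * (real (Suc n) + 1) powr \<delta>" by (intro mult_right_mono) auto
    finally show ?thesis by (simp add: add.commute)
  qed
  have r_bound: "\<bar>r n\<bar> \<le> (S * \<bar>G\<bar> * 2 powr \<delta>) * (real n + 1) powr \<delta>" for n
  proof -
    have "\<bar>r n\<bar> \<le> S * (\<bar>G\<bar> * (real (Suc (Suc n))) powr \<delta>)"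
      unfolding r_def abs_mult by (intro mult_mono e' \<sigma>_bound S0) auto
    also have "\<dots> \<le> S * (\<bar>G\<bar> * (2 * (real n + 1)) powr \<delta>)"
      using S0 \<delta> by (intro mult_left_mono powr_mono2) auto
    also have "\<dots> = (S * \<bar>G\<bar> * 2 powr \<delta>) * (real n + 1) powr \<delta>" by (subst powr_mult) simp_all
    finally show ?thesis .
  qed
  have bw: "(\<lambda>n. b n * l1_norm (W n)) \<longlonglongrightarrow> 0"
  proof (rule coupled_rec_tendsto_0[where t = t and C = c and \<delta> = \<delta> and z = y and g = "\<lambda>n. \<bar>r n\<bar>"])
    show "y (Suc n) \<le> t * y n + c * \<bar>b n\<bar> * l1_norm (W n) + \<bar>r n\<bar>" for n
      using y_Suc[of n] l1_h[of r n] by simp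
    show "\<bar>r n\<bar> \<le> (S * \<bar>G\<bar> * 2 powr \<delta>) * (real n + 1) powr \<delta>" for n by (rule r_bound)
    show "l1_norm (W n) \<le> c * (\<Sum>m<n. \<bar>b m\<bar> * y m)" for n by (rule l1_W)
  qed (use t c \<delta> y_nonneg b_sum b_bound in \<open>auto simp: b_def\<close>)

  define d where "d n = Z n - \<gamma> (Suc n)" for n
  have d: "d n \<in> carrier_vec p" for n using Z gamma_carrier by (simp add: d_def)
  have d_rec: "d (Suc n) = ?A *\<^sub>v d n + h r' n" for n
  proof -
    have "?A *\<^sub>v d n = ?A *\<^sub>v Z n - ?A *\<^sub>v \<gamma> (Suc n)"
      unfolding d_def by (rule mult_minus_distrib_mat_vec[OF A Z gamma_carrier])
    moreover have "?A *\<^sub>v Z n \<in> carrier_vec p" "?A *\<^sub>v \<gamma> (Suc n) \<in> carrier_vec p"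
      by (rule mult_mat_vec_carrier[OF A Z], rule mult_mat_vec_carrier[OF A gamma_carrier])
    ultimately show ?thesis
      using AW[of n] unfolding d_def[of "Suc n"] Z_rec gamma[of "Suc n"] ar_step_def h_def r_def r'_def
      by (intro eq_vecI) (simp_all add: carrier_matD[OF A] algebra_simps)
  qed
  have r'_lim: "r' \<longlonglongrightarrow> 0"
  proof (rule Lim_null_comparison[OF always_eventually], rule allI)
    fix n
    \<comment> \<open>The rate -2\<delta> of \<sigma> outweighs the growth \<delta> of e and leaves
      -\<delta>.\<close>
    have "norm (r' n) \<le> (D * real (Suc (Suc n)) powr (- 2 * \<delta>)) * (\<bar>G\<bar> * real (Suc (Suc n)) powr \<delta>)"
      unfolding r'_def real_norm_def abs_mult
      by (intro mult_mono e' \<sigma>_rate order_trans[OF abs_ge_zero \<sigma>_rate]) auto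
    also have "\<dots> = D * \<bar>G\<bar> * real (Suc (Suc n)) powr (- \<delta>)"
      using powr_add[of "real (Suc (Suc n))" "- 2 * \<delta>" \<delta>] by simp
    finally show "norm (r' n) \<le> D * \<bar>G\<bar> * real (Suc (Suc n)) powr (- \<delta>)" .
  next
    show "(\<lambda>n. D * \<bar>G\<bar> * real (Suc (Suc n)) powr (- \<delta>)) \<longlonglongrightarrow> 0"
      using \<delta> by real_asymp
  qed
  have l1_h_lim: "(\<lambda>n. l1_norm (h r' n)) \<longlonglongrightarrow> 0"
  proof (rule Lim_null_comparison[OF always_eventually], rule allI)
    show "norm (l1_norm (h r' n)) \<le> c * \<bar>b n * l1_norm (W n)\<bar> + \<bar>r' n\<bar>" for n
      using l1_h[of r' n] by (simp add: abs_mult mult_ac)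
    show "(\<lambda>n. c * \<bar>b n * l1_norm (W n)\<bar> + \<bar>r' n\<bar>) \<longlonglongrightarrow> 0"
      by (rule tendsto_add_zero[OF tendsto_mult_right_zero[OF tendsto_rabs_zero[OF bw]] tendsto_rabs_zero[OF r'_lim]])
  qed
  define y' where "y' = rec_nat (l1_norm (d 0)) (\<lambda>n a. t * a + l1_norm (h r' n))"
  have y'_0: "y' 0 = l1_norm (d 0)" and y'_Suc: "y' (Suc n) = t * y' n + l1_norm (h r' n)" for n
    by (simp_all add: y'_def)
  have d_y: "l1_norm (d n) \<le> c * y' n" for n
    by (rule affine_rec_norm_bound[OF A c bound, where x = d and u = "h r'" and y = y'])
      (rule d h d_rec y'_Suc less_imp_le[OF t(1)] order.refl | simp only: y'_0)+
  have "y' \<longlonglongrightarrow> 0"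
    using t by (intro linear_rec_tendsto_0[OF _ _ l1_h_lim y'_Suc]) auto
  then have y'_lim: "(\<lambda>n. c * y' n) \<longlonglongrightarrow> 0" by (rule tendsto_mult_right_zero)
  have "(\<lambda>n. eucl_norm (vec_first (ar_zeta p \<theta> k x (Suc n)) p - \<gamma> (Suc n))) \<longlonglongrightarrow> 0"
  proof (rule Lim_null_comparison[OF always_eventually y'_lim], rule allI)
    fix n
    have "vec_first (ar_zeta p \<theta> k x (Suc n)) p - \<gamma> (Suc n) = d n"
      by (simp add: vec_first_ar_zeta Z_def d_def)
    moreover have "eucl_norm (d n) \<ge> 0" by (simp add: eucl_norm_def sum_nonneg)
    ultimately show "norm (eucl_norm (vec_first (ar_zeta p \<theta> k x (Suc n)) p - \<gamma> (Suc n))) \<le> c * y' n"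
      using order_trans[OF eucl_norm_le_l1_norm d_y[of n]] by simp
  qed
  then show ?thesis by (rule filterlim_sequentially_Suc[THEN iffD1])
qed

lemma bigo_sqrt_powr:
  fixes b :: "nat \<Rightarrow> real"
  assumes "(\<lambda>n. (b n)\<^sup>2) \<in> O(\<lambda>n. real n powr (- \<alpha>))" and \<alpha>: "\<alpha> \<ge> 0"
  shows "(\<lambda>n. b (Suc n)) \<in> O(\<lambda>n. real n powr (- (\<alpha> / 2)))"
proof -
  from assms(1) obtain c where c: "c > 0" and "\<forall>\<^sub>F n in sequentially. norm ((b n)\<^sup>2) \<le> c * norm (real n powr (- \<alpha>))"
    by (rule landau_o.bigE)
  then have "\<forall>\<^sub>F n in sequentially. norm ((b (Suc n))\<^sup>2) \<le> c * norm (real (Suc n) powr (- \<alpha>))"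
    by (simp only: eventually_sequentially_Suc[of "\<lambda>n. norm ((b n)\<^sup>2) \<le> c * norm (real n powr (- \<alpha>))"])
  then have "\<forall>\<^sub>F n in sequentially. norm (b (Suc n)) \<le> sqrt c * norm (real n powr (- (\<alpha> / 2)))"
    using eventually_gt_at_top[of 0]
  proof eventually_elim
    case (elim n)
    have "(b (Suc n))\<^sup>2 \<le> c * real (Suc n) powr (- \<alpha>)" using elim by simp
    also have "\<dots> \<le> c * real n powr (- \<alpha>)" using elim c \<alpha> by (intro mult_left_mono powr_mono2') auto
    also have "real n powr (- \<alpha>) = (real n powr (- (\<alpha> / 2)))\<^sup>2"
      by (simp add: power2_eq_square powr_add[symmetric])
    finally have "sqrt ((b (Suc n))\<^sup>2) \<le> sqrt (c * (real n powr (- (\<alpha> / 2)))\<^sup>2)" by (rule real_sqrt_le_mono)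
    then show ?case by (simp add: real_sqrt_mult)
  qed
  then show ?thesis by (rule landau_o.bigI[rotated]) (use c in simp)
qed

theorem proposition5p1:
  fixes M :: "'w measure"
    and \<xi> \<epsilon> :: "nat \<Rightarrow> 'w \<Rightarrow> real"
    and \<sigma> :: "nat \<Rightarrow> real"
    and k :: "nat \<Rightarrow> nat \<Rightarrow> real"
    and f :: "real \<Rightarrow> real"
    and p :: nat
    and \<theta> :: "nat \<Rightarrow> real"
    and \<alpha>\<^sub>1 \<alpha>\<^sub>2 \<sigma>_inf :: real
    and \<gamma> :: "nat \<Rightarrow> 'w \<Rightarrow> real vec"
  assumes "prob_space M"
    and "p \<ge> 1"
    and noise_stationary: "strictly_stationary M borel (\<lambda>n. \<xi> (Suc n))"
    and noise_gaussian: "gaussian_process M {1..} \<xi>"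
    and noise_centered: "\<And>n. n \<ge> 1 \<Longrightarrow> (\<integral>\<omega>. \<xi> n \<omega> \<partial>M) = 0"
    and noise_normalized: "acov M \<xi> 0 = 1"
    and noise_spectral_density: "spectral_density (acov M \<xi>) f"
    and sigma_1: "\<sigma> 1 = 1"
    and sigma_pos: "\<And>n. n \<ge> 1 \<Longrightarrow> \<sigma> n > 0"
    and eps_innovation: "\<And>n. n \<ge> 1 \<Longrightarrow> AE \<omega> in M. \<sigma> n * \<epsilon> n \<omega> = innovation M \<xi> n \<omega>"
    and eps_indep: "prob_space.indep_vars M (\<lambda>_. borel) \<epsilon> {1..}"
    and eps_normal: "\<And>n. n \<ge> 1 \<Longrightarrow> distributed M lborel (\<epsilon> n) std_normal_density"
    and k_diag: "\<And>n. n \<ge> 1 \<Longrightarrow> k n n = 1"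
    and k_innovation:
      "\<And>n. n \<ge> 1 \<Longrightarrow> AE \<omega> in M. \<sigma> n * \<epsilon> n \<omega> = (\<Sum>i=1..n. k n i * \<xi> i \<omega>)"
    and stable: "spectral_radius (map_mat complex_of_real (companion p \<theta>)) < 1"
    and "\<alpha>\<^sub>1 > 0" and "acov M \<xi> \<in> O(\<lambda>n. real n powr (- \<alpha>\<^sub>1))"
    and "log_integrable f"
    and "\<alpha>\<^sub>2 > 1" and "(\<lambda>n. (pacf k n)\<^sup>2) \<in> O(\<lambda>n. real n powr (- \<alpha>\<^sub>2))"
    and sigma_inf: "\<sigma>_inf = lim \<sigma>"
    and gamma_measurable: "\<And>n. \<gamma> n \<in> measurable M (vec_borel p)"
    and gamma_rec:
      "\<And>n. n \<ge> 1 \<Longrightarrow>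
         AE \<omega> in M. \<gamma> n \<omega> = ar_step p (companion p \<theta>) \<sigma>_inf (\<gamma> (n - 1) \<omega>) (\<epsilon> n \<omega>)"
    and gamma_0_law:
      "ar_stationary_law p (companion p \<theta>) \<sigma>_inf (distr M (vec_borel p) (\<gamma> 0))"
    and gamma_0_indep:
      "prob_space.indep_set M
         (sets (vimage_algebra (space M) (\<gamma> 0) (vec_borel p)))
         (sets (vimage_algebra (space M) (\<lambda>\<omega> n. \<epsilon> (Suc n) \<omega>) (Pi\<^sub>M UNIV (\<lambda>_::nat. borel))))"
  shows "\<sigma> \<longlonglongrightarrow> \<sigma>_inf \<and> \<sigma>_inf > 0 \<and>
    strictly_stationary M (vec_borel p) \<gamma> \<and>
    ergodic_process M (vec_borel p) \<gamma> \<and>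
    (AE \<omega> in M.
       (\<lambda>n. eucl_norm (vec_first (ar_zeta p \<theta> k (\<lambda>i. \<xi> i \<omega>) n) p - \<gamma> n \<omega>)) \<longlonglongrightarrow> 0)"
proof -
  interpret prob_space M by fact
  let ?A = "companion p \<theta>" and ?b = "pacf k"
  have A: "?A \<in> carrier_mat p p" by simp
  define c where "c i j = expectation (\<lambda>\<omega>. \<xi> i \<omega> * \<xi> j \<omega>)" for i j
  interpret levinson c k "\<lambda>n. (\<sigma> n)\<^sup>2"
    unfolding c_def[abs_def]
    by (rule levinson_noise[OF noise_stationary eps_indep eps_normal k_diag k_innovation sigma_pos])
  \<comment> \<open>Half of the excess of \<open>\<alpha>\<^sub>2\<close> over 1: the weight n^q
    keeps the squares of \<beta> summable since \<open>q - \<alpha>\<^sub>2 < -1\<close>. With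
    \<delta> = q / 2 the rate of \<sigma> is of order -2\<delta>, and
    \<open>\<alpha>\<^sub>2 / 2 = 1/2 + 2 * \<delta>\<close>, as
    \<open>zeta_approaches_gamma\<close> requires.\<close>
  define q where "q = (\<alpha>\<^sub>2 - 1) / 2"
  have q: "q > 0" using \<open>\<alpha>\<^sub>2 > 1\<close> by (simp add: q_def)
  note b_bigo = \<open>(\<lambda>n. (pacf k n)\<^sup>2) \<in> O(\<lambda>n. real n powr (- \<alpha>\<^sub>2))\<close>
  have b_sum: "summable (\<lambda>n. real n powr q * (?b n)\<^sup>2)"
  proof (rule summable_comparison_test_bigo)
    have "(\<lambda>n. real n powr q * (?b n)\<^sup>2) \<in> O(\<lambda>n. real n powr q * real n powr (- \<alpha>\<^sub>2))"
      by (intro landau_o.big.mult landau_o.big_refl b_bigo)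
    then show "(\<lambda>n. real n powr q * (?b n)\<^sup>2) \<in> O(\<lambda>n. real n powr (q - \<alpha>\<^sub>2))"
      by (simp add: powr_add[symmetric])
    have "q - \<alpha>\<^sub>2 < -1" using \<open>\<alpha>\<^sub>2 > 1\<close> by (simp add: q_def field_simps)
    then show "summable (\<lambda>n. norm (real n powr (q - \<alpha>\<^sub>2)))" by (simp add: summable_real_powr_iff)
  qed
  have b_sq_sum: "summable (\<lambda>n. (?b (Suc n))\<^sup>2)"
  proof (rule summable_comparison_test'[OF b_sum[THEN summable_Suc_iff[THEN iffD2]]])
    fix n
    have "1 * (?b (Suc n))\<^sup>2 \<le> real (Suc n) powr q * (?b (Suc n))\<^sup>2"
      using q by (intro mult_right_mono ge_one_powr_ge_zero) auto
    then show "norm ((?b (Suc n))\<^sup>2) \<le> real (Suc n) powr q * (?b (Suc n))\<^sup>2" by simp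
  qed
  have var_rec: "(\<sigma> (Suc n))\<^sup>2 = (\<sigma> n)\<^sup>2 * (1 - (?b n)\<^sup>2)" if "n \<ge> 1" for n
    using variances[OF that] that by (simp add: pacf_def)
  obtain L D where L: "L > 0" "(\<lambda>n. (\<sigma> n)\<^sup>2) \<longlonglongrightarrow> L"
    and rate: "\<And>n. n \<ge> 1 \<Longrightarrow> \<bar>(\<sigma> n)\<^sup>2 - L\<bar> \<le> D * real n powr (- q)"
    by (rule product_rec_limit[of "\<lambda>n. (\<sigma> n)\<^sup>2" ?b q thesis]) (use sigma_1 sigma_pos pos var_rec q b_sum that in auto)
  have \<sigma>_lim: "\<sigma> \<longlonglongrightarrow> sqrt L"
  proof (rule Lim_transform_eventually[OF tendsto_real_sqrt[OF L(2)]])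
    show "\<forall>\<^sub>F n in sequentially. sqrt ((\<sigma> n)\<^sup>2) = \<sigma> n"
      using eventually_ge_at_top[of 1] by eventually_elim (use sigma_pos in \<open>simp add: less_imp_le\<close>)
  qed
  then have \<sigma>_inf: "\<sigma>_inf = sqrt L" unfolding sigma_inf by (rule limI)
  then have \<sigma>_inf_pos: "\<sigma>_inf > 0" using L by simp
  \<comment> \<open>The rate passes from the variances to \<sigma> by factoring the difference of
    squares; the factor \<sigma>(n) + \<sigma>_inf is at least \<sigma>_inf > 0.\<close>
  have \<sigma>_rate: "\<bar>\<sigma> n - \<sigma>_inf\<bar> \<le> (D / \<sigma>_inf) * real n powr (- 2 * (q / 2))" if n: "n \<ge> 1" for n
  proof -
    have "\<bar>\<sigma> n - \<sigma>_inf\<bar> * \<sigma>_inf \<le> \<bar>\<sigma> n - \<sigma>_inf\<bar> * (\<sigma> n + \<sigma>_inf)"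
      using sigma_pos[OF n] by (intro mult_left_mono) auto
    also have "\<dots> = \<bar>(\<sigma> n - \<sigma>_inf) * (\<sigma> n + \<sigma>_inf)\<bar>"
      using sigma_pos[OF n] \<sigma>_inf_pos by (simp add: abs_mult)
    also have "(\<sigma> n - \<sigma>_inf) * (\<sigma> n + \<sigma>_inf) = (\<sigma> n)\<^sup>2 - L"
      using L(1) by (simp add: \<sigma>_inf algebra_simps power2_eq_square)
    also have "\<bar>(\<sigma> n)\<^sup>2 - L\<bar> \<le> D * real n powr (- q)" by (rule rate[OF n])
    finally show ?thesis using \<sigma>_inf_pos by (simp add: field_simps)
  qed
  obtain S where S: "\<And>n. \<bar>\<sigma> n\<bar> \<le> S"
    using \<sigma>_lim convergent_imp_Bseq[of \<sigma>] by (auto simp: convergent_def Bseq_def)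
  interpret \<gamma>: stationary_ar M \<epsilon> \<gamma> p ?A \<sigma>_inf
    by unfold_locales (use \<open>p \<ge> 1\<close> stable eps_indep eps_normal gamma_measurable gamma_rec gamma_0_law gamma_0_indep in auto)
  have "AE \<omega> in M. \<exists>G. \<forall>n. \<bar>\<epsilon> (Suc n) \<omega>\<bar> \<le> G * (real n + 1) powr (q / 2)"
    by (rule std_normal_sequence_growth) (use eps_normal q in auto)
  moreover have "AE \<omega> in M. \<forall>n. (\<Sum>i=1..Suc n. k (Suc n) i * \<xi> i \<omega>) = \<sigma> (Suc n) * \<epsilon> (Suc n) \<omega>"
    unfolding AE_all_countable using k_innovation[of "Suc _"] by (simp only: eq_commute[of "\<sigma> _ * _"]) simp
  moreover have "AE \<omega> in M. \<forall>n. \<gamma> (Suc n) \<omega> = ar_step p ?A \<sigma>_inf (\<gamma> n \<omega>) (\<epsilon> (Suc n) \<omega>)"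
    unfolding AE_all_countable using gamma_rec[of "Suc _"] by simp
  ultimately have "AE \<omega> in M. (\<lambda>n. eucl_norm (vec_first (ar_zeta p \<theta> k (\<lambda>i. \<xi> i \<omega>) n) p - \<gamma> n \<omega>)) \<longlonglongrightarrow> 0"
    using AE_space
  proof eventually_elim
    case (elim \<omega>)
    then obtain G where G: "\<And>n. \<bar>\<epsilon> (Suc n) \<omega>\<bar> \<le> G * (real n + 1) powr (q / 2)" by blast
    show ?case
    proof (rule zeta_approaches_gamma[OF \<open>p \<ge> 1\<close> stable])
      show "(\<Sum>i=1..n. k n i * \<xi> i \<omega>) = \<sigma> n * \<epsilon> n \<omega>" if "n \<ge> 1" for n
        using elim(2) that by (cases n) auto
      show "\<gamma> (Suc n) \<omega> = ar_step p ?A \<sigma>_inf (\<gamma> n \<omega>) (\<epsilon> (Suc n) \<omega>)" for n using elim(3) by blast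
      show "\<gamma> n \<omega> \<in> carrier_vec p" for n using measurable_space[OF gamma_measurable elim(4)] by simp
      show "\<bar>\<epsilon> (Suc n) \<omega>\<bar> \<le> G * (real n + 1) powr (q / 2)" for n by (rule G)
      show "q / 2 > 0" using q by simp
      show "\<bar>\<sigma> n\<bar> \<le> S" for n by (rule S)
      show "\<bar>\<sigma> n - \<sigma>_inf\<bar> \<le> (D / \<sigma>_inf) * real n powr (- 2 * (q / 2))" if "n \<ge> 1" for n by (rule \<sigma>_rate[OF that])
      show "summable (\<lambda>n. (?b (Suc n))\<^sup>2)" by (rule b_sq_sum)
      have eq: "\<alpha>\<^sub>2 / 2 = 1/2 + 2 * (q / 2)" by (simp add: q_def field_simps)
      have "(\<lambda>n. ?b (Suc n)) \<in> O(\<lambda>n. real n powr (- (\<alpha>\<^sub>2 / 2)))"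
        by (rule bigo_sqrt_powr[OF b_bigo]) (use \<open>\<alpha>\<^sub>2 > 1\<close> in simp)
      then show "(\<lambda>n. ?b (Suc n)) \<in> O(\<lambda>n. real n powr (- (1/2 + 2 * (q / 2))))"
        unfolding eq .
    qed
  qed
  with \<sigma>_lim \<sigma>_inf \<sigma>_inf_pos \<gamma>.gamma_strictly_stationary \<gamma>.gamma_ergodic show ?thesis by simp
qed

end
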